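(* Let $p>1$ and let $V:\mathbb{Z}^N\to\mathbb{R}$ be a potential on the lattice graph $\mathbb{Z}^N$ with $\inf_{x\in\mathbb{Z}^N}V(x)>-1$. If $V$ is $T$-periodic in $x$ for some positive integer $T$, then the equation $$-\Delta_pu(x)+V(x)|u|^{p-2}u=|u|^{p-2}u\log|u|^p,\quad x\in\mathbb{Z}^N,$$ has a ground state solution $u$. Moreover, $u(x)>0$ for all $x\in\mathbb{Z}^N$ or $u(x)<0$ for all $x\in\mathbb{Z}^N$.
   Context: The lattice graph $\mathbb{Z}^N$ has vertex set $\mathbb{Z}^N$ and edges $\{x,y\}$ with $\sum_{i=1}^N|x_i-y_i|=1$ (written $x\sim y$). A function $g$ on $\mathbb{Z}^N$ is $T$-periodic if $g(x+Te_i)=g(x)$ for all $x\in\mathbb{Z}^N$, $1\le i\le N$, with $e_i$ the $i$-th unit vector. All functions are real valued, $\mu$ is the counting measure, $\int_{\mathbb{Z}^N}f\,d\mu=\sum_xf(x)$. $\Delta_pu(x)=\sum_{y\sim x}|u(y)-u(x)|^{p-2}(u(y)-u(x))$ (with $|t|^{p-2}t=0$ at $t=0$), $|\nabla u(x)|_p=\left(\frac12\sum_{y\sim x}|u(y)-u(x)|^p\right)^{1/p}$. $W^{1,p}(\mathbb{Z}^N)$ is the completion of the finitely supported functions under $\left(\int(|\nabla u|_p^p+|u|^p)d\mu\right)^{1/p}$; the working space is $X=W^{1,p}(\mathbb{Z}^N)$ with the norm $\left(\int(|\nabla u|_p^p+(V+1)|u|^p)d\mu\right)^{1/p}$. The energy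 $J:X\to(-\infty,+\infty]$ is $$J(u)=\frac1p\int_{\mathbb{Z}^N}\left(|\nabla u|_p^p+(V(x)+1)|u|^p\right)d\mu-\frac1p\int_{\mathbb{Z}^N}|u|^p\log|u|^p\,d\mu$$ with $0\log0=0$; $D(J)=\{u\in X:J(u)<+\infty\}$. The Nehari manifold is $$\mathcal{N}=\left\{u\in D(J)\setminus\{0\}:\int_{\mathbb{Z}^N}(|\nabla u|_p^p+V|u|^p)\,d\mu=\int_{\mathbb{Z}^N}|u|^p\log|u|^p\,d\mu\right\}.$$ A solution is $u\in D(J)$ satisfying the equation at every vertex; a ground state solution is a nontrivial solution $u$ with $J(u)=\inf_{\mathcal{N}}J$. *)

theory Defs
  imports "HOL-Analysis.Analysis"
begin

text \<open>The vertex set \<open>\<int>\<^sup>N\<close> is the type \<^typ>\<open>int ^ 'n\<close> with \<open>N = CARD('n) \<ge> 1\<close>.\<close>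

definition adj :: "int ^ 'n \<Rightarrow> int ^ 'n \<Rightarrow> bool"  (infix \<open>\<sim>\<^sub>Z\<close> 50)
  where "x \<sim>\<^sub>Z y \<longleftrightarrow> (\<Sum>i\<in>UNIV. \<bar>x $ i - y $ i\<bar>) = 1"

lemma finite_neighbours: "finite {y. (x :: int ^ 'n) \<sim>\<^sub>Z y}"
proof -
  have "{y. x \<sim>\<^sub>Z y} \<subseteq> vec_lambda ` (\<Pi>\<^sub>E i\<in>UNIV. {x $ i - 1..x $ i + 1})"
  proof
    fix y assume "y \<in> {y. x \<sim>\<^sub>Z y}"
    then have s: "(\<Sum>i\<in>UNIV. \<bar>x $ i - y $ i\<bar>) = 1" by (simp add: adj_def)
    have "\<bar>x $ i - y $ i\<bar> \<le> 1" for i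
      using member_le_sum[of i UNIV "\<lambda>i. \<bar>x $ i - y $ i\<bar>"] s by simp
    then have "vec_nth y \<in> (\<Pi>\<^sub>E i\<in>UNIV. {x $ i - 1..x $ i + 1})"
      by (force simp: PiE_iff abs_le_iff algebra_simps)
    then show "y \<in> vec_lambda ` (\<Pi>\<^sub>E i\<in>UNIV. {x $ i - 1..x $ i + 1})"
      by (metis image_eqI vec_lambda_eta)
  qed
  then show ?thesis
    by (rule finite_subset) (intro finite_imageI finite_PiE; simp)
qed

definition periodic :: "nat \<Rightarrow> (int ^ 'n \<Rightarrow> real) \<Rightarrow> bool"
  where "periodic T g \<longleftrightarrow> (\<forall>x i. g (x + int T *s axis i 1) = g x)"

text \<open>At \<open>t = 0\<close> the factor \<open>t\<close> makes \<open>\<bar>t\<bar> powr (p - 2) * t\<close> vanish, for every \<open>p\<close>.\<close>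

definition p_Laplacian :: "real \<Rightarrow> (int ^ 'n \<Rightarrow> real) \<Rightarrow> int ^ 'n \<Rightarrow> real"
  where "p_Laplacian p u x = (\<Sum>y | x \<sim>\<^sub>Z y. \<bar>u y - u x\<bar> powr (p - 2) * (u y - u x))"

definition grad_norm :: "real \<Rightarrow> (int ^ 'n \<Rightarrow> real) \<Rightarrow> int ^ 'n \<Rightarrow> real"
  where "grad_norm p u x = (1 / 2 * (\<Sum>y | x \<sim>\<^sub>Z y. \<bar>u y - u x\<bar> powr p)) powr (1 / p)"

definition W1p_norm :: "real \<Rightarrow> (int ^ 'n \<Rightarrow> real) \<Rightarrow> real"
  where "W1p_norm p u =
    (\<integral>x. grad_norm p u x powr p + \<bar>u x\<bar> powr p \<partial>count_space UNIV) powr (1 / p)"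

text \<open>
  The completion of the finitely supported functions is realised as a space of functions: the norm
  dominates point evaluations, so an element of the completion is determined by its values, and
  the completion is the closure of the finitely supported functions among those of finite norm.
  Integrability of \<open>u\<close> is required explicitly because the Bochner integral of a non-integrable
  function is \<open>0\<close>; it passes on to \<open>u - \<phi> k\<close>.
\<close>

definition W1p :: "real \<Rightarrow> (int ^ 'n \<Rightarrow> real) set"
  where "W1p p = {u.
    integrable (count_space UNIV) (\<lambda>x. grad_norm p u x powr p + \<bar>u x\<bar> powr p) \<and>
    (\<exists>\<phi> :: nat \<Rightarrow> int ^ 'n \<Rightarrow> real. (\<forall>k. finite {x. \<phi> k x \<noteq> 0}) \<and>
      (\<lambda>k. W1p_norm p (\<lambda>x. u x - \<phi> k x)) \<longlonglongrightarrow> 0)}"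

text \<open>
  Extended-real integral against the counting measure: positive minus negative part. If \<open>V \<ge> -1\<close>
  and \<open>p > 0\<close>, then at least one part is finite in each of the integrals taken in \<open>energy\<close> for
  \<open>u \<in> W1p p\<close>, and all parts are finite in those of \<open>Nehari\<close> for \<open>u\<close> of finite energy.
\<close>

definition ext_integral :: "(int ^ 'n \<Rightarrow> real) \<Rightarrow> ereal"
  where "ext_integral f =
    enn2ereal (\<integral>\<^sup>+x. ennreal (f x) \<partial>count_space UNIV) -
    enn2ereal (\<integral>\<^sup>+x. ennreal (- f x) \<partial>count_space UNIV)"

definition energy :: "real \<Rightarrow> (int ^ 'n \<Rightarrow> real) \<Rightarrow> (int ^ 'n \<Rightarrow> real) \<Rightarrow> ereal"
  where "energy p V u =
    ereal (1 / p) * ext_integral (\<lambda>x. grad_norm p u x powr p + (V x + 1) * \<bar>u x\<bar> powr p) -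
    ereal (1 / p) * ext_integral (\<lambda>x. \<bar>u x\<bar> powr p * ln (\<bar>u x\<bar> powr p))"

definition energy_domain :: "real \<Rightarrow> (int ^ 'n \<Rightarrow> real) \<Rightarrow> (int ^ 'n \<Rightarrow> real) set"
  where "energy_domain p V = {u \<in> W1p p. energy p V u < \<infinity>}"

definition Nehari :: "real \<Rightarrow> (int ^ 'n \<Rightarrow> real) \<Rightarrow> (int ^ 'n \<Rightarrow> real) set"
  where "Nehari p V = {u \<in> energy_domain p V - {\<lambda>x. 0}.
    ext_integral (\<lambda>x. grad_norm p u x powr p + V x * \<bar>u x\<bar> powr p) =
    ext_integral (\<lambda>x. \<bar>u x\<bar> powr p * ln (\<bar>u x\<bar> powr p))}"

definition is_solution :: "real \<Rightarrow> (int ^ 'n \<Rightarrow> real) \<Rightarrow> (int ^ 'n \<Rightarrow> real) \<Rightarrow> bool"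
  where "is_solution p V u \<longleftrightarrow> u \<in> energy_domain p V \<and>
    (\<forall>x. - p_Laplacian p u x + V x * \<bar>u x\<bar> powr (p - 2) * u x =
         \<bar>u x\<bar> powr (p - 2) * u x * ln (\<bar>u x\<bar> powr p))"

definition is_ground_state :: "real \<Rightarrow> (int ^ 'n \<Rightarrow> real) \<Rightarrow> (int ^ 'n \<Rightarrow> real) \<Rightarrow> bool"
  where "is_ground_state p V u \<longleftrightarrow> is_solution p V u \<and> u \<noteq> (\<lambda>x. 0) \<and>
    energy p V u = (INF v\<in>Nehari p V. energy p V v)"

end

theory Submission
  imports Defs "HOL-Complex_Analysis.Great_Picard"
begin

text \<open>
  For a function \<open>u\<close> on the lattice write \<open>M(u) = \<Sum>\<bar>u\<bar>\<^sup>p\<close> (\<open>mass\<close>) and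
  \<open>E(u) = \<Sum>(\<bar>\<nabla>u\<bar>\<^sub>p\<^sup>p + V \<bar>u\<bar>\<^sup>p - \<bar>u\<bar>\<^sup>p log \<bar>u\<bar>\<^sup>p)\<close> (\<open>nehari_functional\<close>). On the domain of the energy
  both sums converge, \<open>p J = E + M\<close>, and the Nehari manifold is \<open>E = 0\<close>, \<open>u \<noteq> 0\<close>; there
  \<open>p J = M\<close>. The logarithm makes the problem almost homogeneous:
  \<open>E(t u) = t\<^sup>p E(u) - t\<^sup>p log(t\<^sup>p) M(u)\<close>. So, with \<open>I\<close> the infimum of \<open>E\<close> over unit mass,
  \<open>E(u) \<ge> I M(u) - M(u) log M(u)\<close> for every \<open>u\<close>. On the Nehari manifold this reads \<open>M \<ge> e\<^sup>I\<close>,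
  and a minimiser of unit mass, rescaled to mass \<open>e\<^sup>I\<close>, attains equality. The ground states are
  exactly the elements of mass \<open>e\<^sup>I\<close> of the Nehari manifold (\<open>ground_state_iff_profile\<close>).

  Existence of the minimiser is a concentration argument. If \<open>\<bar>u\<bar>\<^sup>p \<le> \<delta>\<close> everywhere and \<open>u\<close>
  has unit mass, the entropy term is at least \<open>log (1/\<delta>)\<close>; along a minimising sequence some value
  therefore stays bounded away from \<open>0\<close>, and a translation by periods moves it into a fixed
  finite box. A pointwise limit \<open>u\<close> of a subsequence is then nonzero, with mass \<open>m \<in> (0, 1]\<close>. If
  \<open>m < 1\<close>, cut each member of the sequence along a large finite set into a part of mass about
  \<open>m\<close> and a part of mass about \<open>1 - m\<close>. Cutting costs only the mass next to the cut, which is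
  small in the limit, and the lower bound applied to the two parts gives
  \<open>I \<ge> I - m log m - (1 - m) log (1 - m)\<close>, which is absurd (\<open>nehari_functional_cut\<close>,
  \<open>min_sequence_limit\<close>). So \<open>m = 1\<close>, and Fatou's lemma shows that \<open>u\<close> is a minimiser.

  The equation at a vertex \<open>x\<close> holds because \<open>E - I M + M log M\<close>, which is nonnegative and
  vanishes at a ground state, has a minimum there with respect to the single value \<open>u x\<close>
  (\<open>ground_profile_equation\<close>); only finitely many terms of the sums depend on that value.
  Conversely, multiplying the equation by \<open>u\<close> and summing by parts shows that solutions satisfy
  \<open>E(u) = 0\<close>.

  For the sign, replacing \<open>u\<close> by \<open>\<bar>u\<bar>\<close> does not increase \<open>E\<close> and decreases it strictly if two
  neighbours have opposite signs. Hence \<open>\<bar>u\<bar>\<close> is again a ground state and no such neighbours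
  exist. At a zero of \<open>u\<close> the equation for \<open>\<bar>u\<bar>\<close> forces all neighbours to vanish, and by
  connectedness \<open>u\<close> would be \<open>0\<close>.
\<close>

section \<open>Powers and logarithms\<close>

lemma powr_p_diff_le:
  fixes a b p :: real
  assumes "p > 0"
  shows "\<bar>a - b\<bar> powr p \<le> 2 powr p * (\<bar>a\<bar> powr p + \<bar>b\<bar> powr p)"
proof -
  have "\<bar>a - b\<bar> powr p \<le> (2 * max \<bar>a\<bar> \<bar>b\<bar>) powr p"
    using assms by (intro powr_mono2) auto
  also have "\<dots> = 2 powr p * max \<bar>a\<bar> \<bar>b\<bar> powr p"
    by (simp add: powr_mult)
  also have "\<dots> \<le> 2 powr p * (\<bar>a\<bar> powr p + \<bar>b\<bar> powr p)"
    by (intro mult_left_mono) (auto simp: max_def)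
  finally show ?thesis .
qed

text \<open>
  This bound carries continuity of \<open>x log x\<close> at \<open>0\<close>; it is \<open>ln t \<le> t - 1\<close> at \<open>t = \<bar>x\<bar>\<^sup>-\<^sup>1\<^sup>/\<^sup>2\<close>.
  The absolute values match the convention \<open>ln (- x) = ln x\<close>.
\<close>

lemma entropy_abs_le_sqrt:
  fixes x :: real
  assumes "\<bar>x\<bar> \<le> 1"
  shows "\<bar>x * ln x\<bar> \<le> 2 * sqrt \<bar>x\<bar>"
proof (cases "x = 0")
  case False
  define y where "y = \<bar>x\<bar>"
  have y: "0 < y" "y \<le> 1" using assms False by (auto simp: y_def)
  have "ln (inverse (sqrt y)) \<le> inverse (sqrt y) - 1"
    using y by (intro ln_le_minus_one) simp
  then have "- ln y \<le> 2 * inverse (sqrt y)"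
    using y by (simp add: ln_inverse ln_sqrt)
  then have "y * (- ln y) \<le> y * (2 * inverse (sqrt y))"
    using y by (intro mult_left_mono) auto
  also have "y * (2 * inverse (sqrt y)) = 2 * sqrt y"
    using y by (simp add: field_simps)
  finally have "y * (- ln y) \<le> 2 * sqrt y" .
  moreover have "ln y \<le> 0" using y by simp
  moreover have "\<bar>x * ln x\<bar> = y * (- ln y)"
    using \<open>ln y \<le> 0\<close> by (cases "x \<ge> 0") (auto simp: y_def abs_mult ln_minus)
  ultimately show ?thesis by (simp add: y_def)
qed simp

lemma isCont_entropy: "isCont (\<lambda>x::real. x * ln x) a"
proof (cases "a = 0")
  case True
  have "((\<lambda>x::real. x * ln x) \<longlongrightarrow> 0) (at 0)"
  proof (rule Lim_null_comparison)
    show "\<forall>\<^sub>F x in at 0. norm (x * ln x) \<le> 2 * sqrt \<bar>x::real\<bar>"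
      unfolding eventually_at
      by (rule exI[of _ 1]) (auto intro!: entropy_abs_le_sqrt)
    show "((\<lambda>x::real. 2 * sqrt \<bar>x\<bar>) \<longlongrightarrow> 0) (at 0)"
      by (auto intro!: tendsto_eq_intros)
  qed
  then show ?thesis using True by (simp add: isCont_def)
next
  case False
  have "isCont (\<lambda>x::real. x * ln \<bar>x\<bar>) a" using False by (intro continuous_intros) auto
  moreover have "ln \<bar>x\<bar> = ln x" for x :: real by (cases "x \<ge> 0") (auto simp: ln_minus)
  ultimately show ?thesis by simp
qed

text \<open>
  Away from \<open>0\<close> this is the chain rule for \<open>(t\<^sup>2)\<^sup>p\<^sup>/\<^sup>2\<close>; at \<open>0\<close> the difference quotient is
  bounded by \<open>\<bar>h\<bar>\<^sup>p\<^sup>-\<^sup>1\<close>, which is where \<open>p > 1\<close> enters.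
\<close>

lemma has_field_derivative_powr_abs:
  fixes t p :: real
  assumes "p > 1"
  shows "((\<lambda>t. \<bar>t\<bar> powr p) has_field_derivative p * (\<bar>t\<bar> powr (p - 2) * t)) (at t)"
proof (cases "t = 0")
  case True
  have "((\<lambda>h. (\<bar>h\<bar> powr p) / h) \<longlongrightarrow> 0) (at 0)"
  proof (rule Lim_null_comparison)
    show "\<forall>\<^sub>F h in at 0. norm (\<bar>h\<bar> powr p / h) \<le> \<bar>h::real\<bar> powr (p - 1)"
      unfolding eventually_at
      by (rule exI[of _ 1]) (auto simp: powr_diff)
    show "((\<lambda>h::real. \<bar>h\<bar> powr (p - 1)) \<longlongrightarrow> 0) (at 0)"
      using assms by (intro tendsto_zero_powrI[where b = "p-1"]) (auto intro!: tendsto_eq_intros eventuallyI)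
  qed
  then show ?thesis using True by (simp add: DERIV_def)
next
  case False
  have "((\<lambda>t. (t^2) powr (p / 2)) has_field_derivative (p/2) * (t^2) powr (p/2 - 1) * (2 * t)) (at t)"
    using False by (auto intro!: derivative_eq_intros)
  moreover have "(s^2) powr (p / 2) = \<bar>s\<bar> powr p" for s :: real
  proof -
    have "s^2 = \<bar>s\<bar> powr 2" by simp
    then show ?thesis by (simp only: powr_powr) simp
  qed
  moreover have "(t^2) powr (p / 2 - 1) = \<bar>t\<bar> powr (p - 2)"
  proof -
    have "t^2 = \<bar>t\<bar> powr 2" by simp
    then show ?thesis by (simp only: powr_powr) (simp add: algebra_simps)
  qed
  ultimately show ?thesis by (simp add: mult_ac)
qed

lemma isCont_powr_abs: "p > 1 \<Longrightarrow> isCont (\<lambda>t::real. \<bar>t\<bar> powr p) t"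
  using has_field_derivative_powr_abs by (rule DERIV_isCont)

text \<open>
  At \<open>0\<close> the difference quotient is, up to sign, a multiple of \<open>s log s\<close> with
  \<open>s = \<bar>h\<bar>\<^sup>p\<^sup>-\<^sup>1 \<rightarrow> 0\<close>. So the logarithmic nonlinearity is differentiable in each
  single value of \<open>u\<close>, even where \<open>u\<close> vanishes.
\<close>

lemma has_field_derivative_entropy_powr_abs:
  fixes t p :: real
  assumes "p > 1"
  shows "((\<lambda>t. \<bar>t\<bar> powr p * ln (\<bar>t\<bar> powr p)) has_field_derivative
           p * (\<bar>t\<bar> powr (p - 2) * t) * (ln (\<bar>t\<bar> powr p) + 1)) (at t)"
proof (cases "t = 0")
  case True
  have "((\<lambda>h. (\<bar>h\<bar> powr p * ln (\<bar>h\<bar> powr p)) / h) \<longlongrightarrow> 0) (at 0)"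
  proof (rule Lim_null_comparison)
    define r where "r = (p - 1) / p"
    have r: "r > 0" using assms by (simp add: r_def)
    show "\<forall>\<^sub>F h in at 0. norm (\<bar>h\<bar> powr p * ln (\<bar>h\<bar> powr p) / h)
            \<le> \<bar>p / (p - 1)\<bar> * \<bar>(\<bar>h\<bar> powr (p - 1)) * ln (\<bar>h::real\<bar> powr (p - 1))\<bar>"
      unfolding eventually_at
    proof (intro exI[of _ 1] conjI ballI impI)
      fix h :: real assume "h \<noteq> 0 \<and> dist h 0 < 1"
      then have "\<bar>h\<bar> powr p * ln (\<bar>h\<bar> powr p) / \<bar>h\<bar>
          = p / (p - 1) * (\<bar>h\<bar> powr (p - 1) * ln (\<bar>h\<bar> powr (p - 1)))"
        using assms unfolding ln_powr by (simp add: powr_diff)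
      then have "\<bar>\<bar>h\<bar> powr p * ln (\<bar>h\<bar> powr p) / \<bar>h\<bar>\<bar>
          = \<bar>p / (p - 1) * (\<bar>h\<bar> powr (p - 1) * ln (\<bar>h\<bar> powr (p - 1)))\<bar>" by (rule arg_cong)
      then show "norm (\<bar>h\<bar> powr p * ln (\<bar>h\<bar> powr p) / h)
            \<le> \<bar>p / (p - 1)\<bar> * \<bar>(\<bar>h\<bar> powr (p - 1)) * ln (\<bar>h\<bar> powr (p - 1))\<bar>"
        by (simp only: real_norm_def abs_mult abs_divide abs_abs order_refl)
    qed simp
    have "((\<lambda>h::real. \<bar>h\<bar> powr (p - 1)) \<longlongrightarrow> 0) (at 0)"
      using assms by (intro tendsto_zero_powrI[where b = "p-1"]) (auto intro!: tendsto_eq_intros eventuallyI)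
    from isCont_tendsto_compose[OF isCont_entropy this]
    have "((\<lambda>h::real. (\<bar>h\<bar> powr (p - 1)) * ln (\<bar>h::real\<bar> powr (p - 1))) \<longlongrightarrow> 0) (at 0)" by simp
    then show "((\<lambda>h::real. \<bar>p / (p - 1)\<bar> * \<bar>(\<bar>h\<bar> powr (p - 1)) * ln (\<bar>h::real\<bar> powr (p - 1))\<bar>) \<longlongrightarrow> 0) (at 0)"
      by (intro tendsto_mult_right_zero tendsto_rabs_zero)
  qed
  then show ?thesis using True by (simp add: DERIV_def)
next
  case False
  then have pos: "\<bar>t\<bar> powr p > 0" by simp
  have "((\<lambda>s. s * ln s) has_field_derivative (ln (\<bar>t\<bar> powr p) + 1)) (at (\<bar>t\<bar> powr p))"
    using False by (auto intro!: derivative_eq_intros)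
  from DERIV_chain2[OF this has_field_derivative_powr_abs[OF assms]]
  show ?thesis by (simp add: mult_ac)
qed

section \<open>Sums over a countable vertex set\<close>

lemma integrable_count_space_iff:
  fixes f :: "'a \<Rightarrow> real"
  shows "integrable (count_space UNIV) f \<longleftrightarrow> f summable_on UNIV"
  by (metis Infinite_Set_Sum.abs_summable_on_def abs_summable_equivalent summable_on_iff_abs_summable_on_real)

lemma integral_count_space_eq_infsum:
  fixes f :: "'a \<Rightarrow> real"
  assumes "f summable_on UNIV"
  shows "integral\<^sup>L (count_space UNIV) f = infsum f UNIV"
  using assms infsetsum_infsum[of f UNIV]
  by (simp add: infsetsum_def Infinite_Set_Sum.abs_summable_on_def integrable_count_space_iff)

lemma ext_integral_summable:
  assumes "f summable_on UNIV"
  shows "ext_integral f = ereal (infsum f UNIV)"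
proof -
  have int: "integrable (count_space UNIV) f"
    using assms by (simp add: integrable_count_space_iff)
  have fin: "(\<integral>\<^sup>+x. ennreal (f x) \<partial>count_space UNIV) \<noteq> \<infinity>" "(\<integral>\<^sup>+x. ennreal (- f x) \<partial>count_space UNIV) \<noteq> \<infinity>"
    using int unfolding real_integrable_def by auto
  have eq: "enn2ereal t = ereal (enn2real t)" if "t \<noteq> \<infinity>" for t
    using that by (cases t) auto
  show ?thesis
    using real_lebesgue_integral_def[OF int] integral_count_space_eq_infsum[OF assms]
    unfolding ext_integral_def eq[OF fin(1)] eq[OF fin(2)] by simp
qed

lemma summable_on_abs_comparison:
  fixes f g :: "'a \<Rightarrow> real"
  assumes "g summable_on A" "\<And>x. x \<in> A \<Longrightarrow> \<bar>f x\<bar> \<le> g x"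
  shows "f summable_on A"
proof -
  have "(\<lambda>x. \<bar>f x\<bar>) summable_on A" using summable_on_comparison_test[OF assms(1)] assms(2) by auto
  then show ?thesis using summable_on_iff_abs_summable_on_real[of f A] by simp
qed

lemma summable_on_diff_real:
  fixes f g :: "'a \<Rightarrow> real"
  assumes "f summable_on A" "g summable_on A"
  shows "(\<lambda>x. f x - g x) summable_on A"
  using summable_on_add[OF assms(1), of "\<lambda>x. - g x"] assms(2) by (simp add: summable_on_uminus)

lemma infsum_diff_real:
  fixes f g :: "'a \<Rightarrow> real"
  assumes "f summable_on A" "g summable_on A"
  shows "infsum (\<lambda>x. f x - g x) A = infsum f A - infsum g A"
  using infsum_add[OF assms(1), of "\<lambda>x. - g x"] assms(2) by (simp add: summable_on_uminus infsum_uminus)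

lemma summable_on_finite_sum:
  fixes f :: "'b \<Rightarrow> 'a \<Rightarrow> real"
  assumes "finite I" "\<And>i. i \<in> I \<Longrightarrow> f i summable_on A"
  shows "(\<lambda>x. \<Sum>i\<in>I. f i x) summable_on A"
  using assms by (induction I) (auto intro!: summable_on_add)

lemma infsum_finite_sum:
  fixes f :: "'b \<Rightarrow> 'a \<Rightarrow> real"
  assumes "finite I" "\<And>i. i \<in> I \<Longrightarrow> f i summable_on A"
  shows "infsum (\<lambda>x. \<Sum>i\<in>I. f i x) A = (\<Sum>i\<in>I. infsum (f i) A)"
  using assms by (induction I) (auto simp: infsum_add summable_on_finite_sum)

lemma summable_tail_small:
  fixes w :: "'a \<Rightarrow> real"
  assumes "w summable_on UNIV" "e > 0"
  obtains F where "finite F" "infsum (\<lambda>x. if x \<in> F then 0 else w x) UNIV \<le> e"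
proof -
  obtain F where F: "finite F" "dist (sum w F) (infsum w UNIV) \<le> e"
    using infsum_finite_approximation[OF assms] by auto
  have "infsum (\<lambda>x. if x \<in> F then w x else 0) UNIV = sum w F"
    using infsum_cong_neutral[of UNIV F "\<lambda>x. if x \<in> F then w x else 0" w] F by auto
  moreover have "(\<lambda>x. if x \<in> F then w x else 0) summable_on UNIV"
    using summable_on_cong_neutral[of UNIV F "\<lambda>x. if x \<in> F then w x else 0" w] F by auto
  moreover have "(\<lambda>x. if x \<in> F then 0 else w x) = (\<lambda>x. w x - (if x \<in> F then w x else 0))" by auto
  ultimately have "infsum (\<lambda>x. if x \<in> F then 0 else w x) UNIV = infsum w UNIV - sum w F"
    using infsum_diff_real[OF assms(1)] by simp
  then show ?thesis using F that[of F] by (auto simp: dist_real_def)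
qed

lemma infsum_finite_support:
  assumes "finite S" "\<And>x. x \<notin> S \<Longrightarrow> f x = (0::real)"
  shows "f summable_on UNIV" "infsum f UNIV = sum f S"
  using summable_on_cong_neutral[of UNIV S f f] infsum_cong_neutral[of UNIV S f f] assms by auto

lemma infsum_finite_change:
  fixes f g :: "'a \<Rightarrow> real"
  assumes "f summable_on UNIV" "finite S" "\<And>x. x \<notin> S \<Longrightarrow> g x = f x"
  shows "g summable_on UNIV" "infsum g UNIV = infsum f UNIV + (\<Sum>x\<in>S. g x - f x)"
proof -
  have d: "(\<lambda>x. g x - f x) summable_on UNIV" "infsum (\<lambda>x. g x - f x) UNIV = (\<Sum>x\<in>S. g x - f x)"
    using infsum_finite_support[OF assms(2), of "\<lambda>x. g x - f x"] assms(3) by auto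
  have g: "g = (\<lambda>x. f x + (g x - f x))" by simp
  show "g summable_on UNIV" by (subst g) (intro summable_on_add assms d)
  show "infsum g UNIV = infsum f UNIV + (\<Sum>x\<in>S. g x - f x)"
    by (subst g, subst infsum_add[OF assms(1) d(1)]) (simp add: d(2))
qed

text \<open>
  Fatou's lemma for sums: every finite partial sum of the limit is a limit
  of finite partial sums.
\<close>

lemma infsum_fatou:
  fixes f :: "nat \<Rightarrow> 'a \<Rightarrow> real"
  assumes "\<And>n x. f n x \<ge> 0" "\<And>n. f n summable_on UNIV" "\<And>x. (\<lambda>n. f n x) \<longlonglongrightarrow> g x"
    and "(\<lambda>n. infsum (f n) UNIV) \<longlonglongrightarrow> C"
  shows "g summable_on UNIV" "infsum g UNIV \<le> C"
proof -
  have g: "g x \<ge> 0" for x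
    by (rule LIMSEQ_le_const[OF assms(3)]) (use assms(1) in auto)
  have fin: "sum g F \<le> C" if "finite F" for F
  proof (rule LIMSEQ_le[OF _ assms(4)])
    show "(\<lambda>n. \<Sum>x\<in>F. f n x) \<longlonglongrightarrow> sum g F" by (intro tendsto_sum assms)
    show "\<exists>N. \<forall>n\<ge>N. sum (f n) F \<le> infsum (f n) UNIV"
      using that assms by (auto intro!: exI[of _ 0] finite_sum_le_infsum)
  qed
  show s: "g summable_on UNIV"
    by (rule nonneg_bdd_above_summable_on) (use g fin in \<open>auto intro!: bdd_aboveI2[where M = C]\<close>)
  show "infsum g UNIV \<le> C" by (rule infsum_le_finite_sums[OF s]) (use fin in auto)
qed

section \<open>The lattice\<close>

text \<open>
  The \<open>2N\<close> vectors \<open>\<plusminus>e\<^sub>i\<close>, as the neighbours of the origin. Indexing neighbours by steps turns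
  a sum over edges into finitely many sums over the whole lattice, to which translation applies.
\<close>

definition steps :: "(int ^ 'n) set" where "steps = {e. 0 \<sim>\<^sub>Z e}"

lemma finite_steps [simp]: "finite (steps :: (int ^ 'n) set)"
  by (simp add: steps_def finite_neighbours)

lemma adj_sym: "x \<sim>\<^sub>Z y \<longleftrightarrow> y \<sim>\<^sub>Z (x :: int ^ 'n)"
  by (simp add: adj_def abs_minus_commute)

lemma not_adj_self: "\<not> x \<sim>\<^sub>Z x"
  by (simp add: adj_def)

lemma adj_translate: "x + z \<sim>\<^sub>Z y + z \<longleftrightarrow> x \<sim>\<^sub>Z (y :: int ^ 'n)"
  by (simp add: adj_def)

lemma sum_neighbours: "(\<Sum>y | x \<sim>\<^sub>Z y. f y) = (\<Sum>e\<in>steps. f (x + e :: int ^ 'n))"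
proof (rule sum.reindex_bij_witness[where i = "\<lambda>e. x + e" and j = "\<lambda>y. y - x"])
  show "a - x \<in> steps" if "a \<in> {y. x \<sim>\<^sub>Z y}" for a
    using that adj_translate[of 0 x "a - x"] by (simp add: steps_def)
  show "x + b \<in> {y. x \<sim>\<^sub>Z y}" if "b \<in> steps" for b
    using that adj_translate[of 0 x b] by (simp add: steps_def add.commute)
qed auto

lemma bij_translate: "bij (\<lambda>x :: int ^ 'n. x + a)"
  by (rule o_bij[of "\<lambda>x. x - a"]) auto

lemma infsum_translate: "infsum (\<lambda>x. f (x + a)) UNIV = infsum f (UNIV :: (int ^ 'n) set)"
  using infsum_reindex_bij_betw[OF bij_translate, of f] .

lemma summable_on_translate:
  "(\<lambda>x. f (x + a)) summable_on UNIV \<longleftrightarrow> f summable_on (UNIV :: (int ^ 'n) set)"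
  using summable_on_reindex_bij_betw[OF bij_translate, of f] .

lemma uminus_steps: "- e \<in> steps \<longleftrightarrow> e \<in> (steps :: (int ^ 'n) set)"
  by (simp add: steps_def adj_def)

text \<open>
  Reversal of edges: the step \<open>e\<close> is traded for \<open>- e\<close> after a translation by \<open>e\<close>. This is the
  summation by parts behind \<open>infsum_p_Laplacian_mult\<close>.
\<close>

lemma infsum_edges_swap:
  fixes F :: "int ^ 'n \<Rightarrow> int ^ 'n \<Rightarrow> real"
  assumes "\<And>e. e \<in> steps \<Longrightarrow> (\<lambda>x. F x (x + e)) summable_on UNIV"
  shows "infsum (\<lambda>x. \<Sum>y | x \<sim>\<^sub>Z y. F x y) UNIV = infsum (\<lambda>x. \<Sum>y | x \<sim>\<^sub>Z y. F y x) UNIV"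
    and "(\<lambda>x. \<Sum>y | x \<sim>\<^sub>Z y. F x y) summable_on UNIV"
    and "(\<lambda>x. \<Sum>y | x \<sim>\<^sub>Z y. F y x) summable_on UNIV"
proof -
  have eq: "(\<lambda>x. F (x + e) x) = (\<lambda>x. (\<lambda>x. F x (x + - e)) (x + e))" for e by simp
  have s: "(\<lambda>x. F (x + e) x) summable_on UNIV" if "e \<in> steps" for e
    unfolding eq[of e] summable_on_translate[of "\<lambda>x. F x (x + - e)"]
    using that uminus_steps[of e] by (intro assms) simp
  have "infsum (\<lambda>x. \<Sum>y | x \<sim>\<^sub>Z y. F y x) UNIV = (\<Sum>e\<in>steps. infsum (\<lambda>x. F (x + e) x) UNIV)"
    unfolding sum_neighbours by (rule infsum_finite_sum) (auto simp: s)
  also have "\<dots> = (\<Sum>e\<in>steps. infsum (\<lambda>x. F x (x + - e)) UNIV)"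
    unfolding eq by (subst infsum_translate) simp
  also have "\<dots> = (\<Sum>e\<in>steps. infsum (\<lambda>x. F x (x + e)) UNIV)"
    by (rule sum.reindex_bij_witness[where i = uminus and j = uminus]) (auto simp: uminus_steps)
  also have "\<dots> = infsum (\<lambda>x. \<Sum>y | x \<sim>\<^sub>Z y. F x y) UNIV"
    unfolding sum_neighbours by (rule infsum_finite_sum[symmetric]) (auto simp: assms)
  finally show "infsum (\<lambda>x. \<Sum>y | x \<sim>\<^sub>Z y. F x y) UNIV = infsum (\<lambda>x. \<Sum>y | x \<sim>\<^sub>Z y. F y x) UNIV" ..
  show "(\<lambda>x. \<Sum>y | x \<sim>\<^sub>Z y. F x y) summable_on UNIV" "(\<lambda>x. \<Sum>y | x \<sim>\<^sub>Z y. F y x) summable_on UNIV"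
    unfolding sum_neighbours by (auto intro!: summable_on_finite_sum simp: assms s)
qed

lemma infsum_neighbours_add:
  fixes w :: "int ^ 'n \<Rightarrow> real"
  assumes "w summable_on UNIV"
  shows "(\<lambda>x. \<Sum>y | x \<sim>\<^sub>Z y. w x + w y) summable_on UNIV"
    and "infsum (\<lambda>x. \<Sum>y | x \<sim>\<^sub>Z y. w x + w y) UNIV = 2 * card (steps :: (int ^ 'n) set) * infsum w UNIV"
proof -
  have s: "(\<lambda>x. w x + w (x + e)) summable_on UNIV" for e
    using assms by (intro summable_on_add) (auto simp: summable_on_translate)
  show "(\<lambda>x. \<Sum>y | x \<sim>\<^sub>Z y. w x + w y) summable_on UNIV"
    unfolding sum_neighbours by (intro summable_on_finite_sum s) simp
  have "infsum (\<lambda>x. \<Sum>y | x \<sim>\<^sub>Z y. w x + w y) UNIV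
      = (\<Sum>e\<in>(steps :: (int ^ 'n) set). infsum (\<lambda>x. w x + w (x + e)) UNIV)"
    unfolding sum_neighbours by (intro infsum_finite_sum s) simp
  also have "\<dots> = (\<Sum>e\<in>(steps :: (int ^ 'n) set). 2 * infsum w UNIV)"
    using assms by (subst infsum_add) (auto simp: summable_on_translate infsum_translate)
  finally show "infsum (\<lambda>x. \<Sum>y | x \<sim>\<^sub>Z y. w x + w y) UNIV = 2 * card (steps :: (int ^ 'n) set) * infsum w UNIV"
    by simp
qed

text \<open>
  From \<open>b \<noteq> a\<close> one coordinate can be moved by \<open>1\<close> towards \<open>a\<close>, which decreases the \<open>\<ell>\<^sup>1\<close> distance.
\<close>

lemma lattice_connected:
  fixes S :: "(int ^ 'n) set"
  assumes "a \<in> S" "\<And>x y. x \<in> S \<Longrightarrow> x \<sim>\<^sub>Z y \<Longrightarrow> y \<in> S"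
  shows "b \<in> S"
proof (induction "nat (\<Sum>i\<in>UNIV. \<bar>b $ i - a $ i\<bar>)" arbitrary: b rule: less_induct)
  case less
  show ?case
  proof (cases "b = a")
    case False
    then obtain j where j: "b $ j \<noteq> a $ j" by (auto simp: vec_eq_iff)
    define s where "s = sgn (a $ j - b $ j)"
    define c where "c = b + axis j s"
    have s: "\<bar>s\<bar> = 1" using j by (auto simp: s_def sgn_if)
    have cj: "c $ i = (if i = j then b $ j + s else b $ i)" for i
      by (simp add: c_def axis_def)
    have "(\<Sum>i\<in>UNIV. \<bar>c $ i - b $ i\<bar>) = (\<Sum>i\<in>UNIV. if i = j then \<bar>s\<bar> else 0)"
      by (rule sum.cong) (auto simp: cj)
    then have adj: "c \<sim>\<^sub>Z b" by (simp add: adj_def s)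
    have "(\<Sum>i\<in>UNIV. \<bar>c $ i - a $ i\<bar>) < (\<Sum>i\<in>UNIV. \<bar>b $ i - a $ i\<bar>)"
    proof (rule sum_strict_mono_ex1)
      show "\<exists>i\<in>UNIV. \<bar>c $ i - a $ i\<bar> < \<bar>b $ i - a $ i\<bar>"
        using j by (intro bexI[of _ j]) (auto simp: cj s_def sgn_if)
      show "\<forall>i\<in>UNIV. \<bar>c $ i - a $ i\<bar> \<le> \<bar>b $ i - a $ i\<bar>"
        using j by (auto simp: cj s_def sgn_if)
    qed simp
    moreover have "0 \<le> (\<Sum>i\<in>UNIV. \<bar>c $ i - a $ i\<bar>)" by (intro sum_nonneg) auto
    ultimately have "c \<in> S" by (intro less) linarith
    then show ?thesis using assms(2) adj by blast
  qed (use assms in auto)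
qed

section \<open>Energy, entropy and the Nehari manifold\<close>

definition mass :: "real \<Rightarrow> (int ^ 'n \<Rightarrow> real) \<Rightarrow> real"
  where "mass p u = (\<Sum>\<^sub>\<infinity>x. \<bar>u x\<bar> powr p)"

definition finite_entropy :: "real \<Rightarrow> (int ^ 'n \<Rightarrow> real) \<Rightarrow> bool"
  where "finite_entropy p u \<longleftrightarrow> (\<lambda>x. \<bar>u x\<bar> powr p) summable_on UNIV \<and>
    (\<lambda>x. \<bar>u x\<bar> powr p * ln (\<bar>u x\<bar> powr p)) summable_on UNIV"

definition edge_energy :: "real \<Rightarrow> (int ^ 'n \<Rightarrow> real) \<Rightarrow> int ^ 'n \<Rightarrow> real"
  where "edge_energy p u x = 1 / 2 * (\<Sum>y | x \<sim>\<^sub>Z y. \<bar>u y - u x\<bar> powr p)"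

definition nehari_density :: "real \<Rightarrow> (int ^ 'n \<Rightarrow> real) \<Rightarrow> (int ^ 'n \<Rightarrow> real) \<Rightarrow> int ^ 'n \<Rightarrow> real"
  where "nehari_density p V u x =
    edge_energy p u x + V x * \<bar>u x\<bar> powr p - \<bar>u x\<bar> powr p * ln (\<bar>u x\<bar> powr p)"

text \<open>
  The difference of the two sides of the constraint that defines the Nehari manifold.
\<close>

definition nehari_functional :: "real \<Rightarrow> (int ^ 'n \<Rightarrow> real) \<Rightarrow> (int ^ 'n \<Rightarrow> real) \<Rightarrow> real"
  where "nehari_functional p V u = (\<Sum>\<^sub>\<infinity>x. nehari_density p V u x)"

lemma edge_energy_nonneg: "edge_energy p u x \<ge> 0"
  by (simp add: edge_energy_def sum_nonneg)

lemma grad_norm_powr: "p > 0 \<Longrightarrow> grad_norm p u x powr p = edge_energy p u x"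
  using edge_energy_nonneg[of p u x] by (simp add: grad_norm_def edge_energy_def powr_powr)

lemma edge_energy_le:
  assumes "p > 0"
  shows "edge_energy p u x \<le> 2 powr p / 2 * (\<Sum>y | x \<sim>\<^sub>Z y. \<bar>u x\<bar> powr p + \<bar>u y\<bar> powr p)"
proof -
  have "(\<Sum>y | x \<sim>\<^sub>Z y. \<bar>u y - u x\<bar> powr p) \<le> (\<Sum>y | x \<sim>\<^sub>Z y. 2 powr p * (\<bar>u x\<bar> powr p + \<bar>u y\<bar> powr p))"
    using powr_p_diff_le[OF assms] by (intro sum_mono) (simp add: add.commute)
  then show ?thesis by (simp add: edge_energy_def sum_distrib_left[symmetric])
qed

lemma edge_energy_summable:
  fixes u :: "int ^ 'n \<Rightarrow> real"
  assumes "p > 0" "(\<lambda>x. \<bar>u x\<bar> powr p) summable_on UNIV"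
  shows "edge_energy p u summable_on UNIV"
    and "infsum (edge_energy p u) UNIV \<le> 2 powr p * card (steps :: (int ^ 'n) set) * mass p u"
proof -
  let ?B = "\<lambda>x. 2 powr p / 2 * (\<Sum>y | x \<sim>\<^sub>Z y. \<bar>u x\<bar> powr p + \<bar>u y\<bar> powr p)"
  have B: "?B summable_on UNIV"
    by (intro summable_on_cmult_right infsum_neighbours_add assms)
  show s: "edge_energy p u summable_on UNIV"
    by (rule summable_on_comparison_test[OF B]) (rule edge_energy_le[OF assms(1)], rule edge_energy_nonneg)
  have "infsum (edge_energy p u) UNIV \<le> infsum ?B UNIV"
    by (intro infsum_mono s B edge_energy_le assms)
  also have "\<dots> = 2 powr p / 2 * (2 * card (steps :: (int ^ 'n) set) * mass p u)"
    unfolding infsum_cmult_right' infsum_neighbours_add(2)[OF assms(2)] mass_def ..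
  finally show "infsum (edge_energy p u) UNIV \<le> 2 powr p * card (steps :: (int ^ 'n) set) * mass p u" by simp
qed

lemma mass_nonneg: "mass p u \<ge> 0"
  by (simp add: mass_def infsum_nonneg)

lemma mass_zero: "mass p (\<lambda>x. 0) = 0"
  by (simp add: mass_def)

lemma powr_le_mass:
  assumes "(\<lambda>x. \<bar>u x\<bar> powr p) summable_on UNIV"
  shows "\<bar>u x\<bar> powr p \<le> mass p u"
  using finite_sum_le_infsum[OF assms, of "{x}"] by (simp add: mass_def)

lemma mass_pos:
  assumes "(\<lambda>x. \<bar>u x\<bar> powr p) summable_on UNIV" "u \<noteq> (\<lambda>x. 0)"
  shows "mass p u > 0"
proof -
  obtain x where "u x \<noteq> 0" using assms(2) by auto
  then have "0 < \<bar>u x\<bar> powr p" by simp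
  then show ?thesis using powr_le_mass[OF assms(1), of x] by linarith
qed

text \<open>
  Differences along edges are controlled by values, so the gradient term of the norm is bounded by a
  multiple of the mass. Hence \<open>W\<^sup>1\<^sup>,\<^sup>p\<close> is \<open>\<ell>\<^sup>p\<close>, and truncations to finite sets with small
  remaining mass provide the approximating sequence.
\<close>

lemma W1p_iff:
  fixes u :: "int ^ 'n \<Rightarrow> real"
  assumes p: "p > 1"
  shows "u \<in> W1p p \<longleftrightarrow> (\<lambda>x. \<bar>u x\<bar> powr p) summable_on UNIV"
proof
  assume "u \<in> W1p p"
  then have "(\<lambda>x. grad_norm p u x powr p + \<bar>u x\<bar> powr p) summable_on UNIV"
    by (simp add: W1p_def integrable_count_space_iff)
  then show "(\<lambda>x. \<bar>u x\<bar> powr p) summable_on UNIV"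
    by (rule summable_on_comparison_test) auto
next
  assume w: "(\<lambda>x. \<bar>u x\<bar> powr p) summable_on UNIV"
  have norm_eq: "W1p_norm p v = (infsum (edge_energy p v) UNIV + mass p v) powr (1 / p)"
    if "(\<lambda>x. \<bar>v x\<bar> powr p) summable_on UNIV" for v :: "int ^ 'n \<Rightarrow> real"
    using edge_energy_summable(1)[of p v] that p
    by (simp add: W1p_norm_def grad_norm_powr integral_count_space_eq_infsum summable_on_add infsum_add mass_def)
  have "\<exists>F. finite F \<and> infsum (\<lambda>x. if x \<in> F then 0 else \<bar>u x\<bar> powr p) UNIV \<le> 1 / Suc k" for k
    by (rule summable_tail_small[OF w, of "1 / Suc k"]) auto
  then obtain F where F: "\<And>k. finite (F k)"
      "\<And>k. infsum (\<lambda>x. if x \<in> F k then 0 else \<bar>u x\<bar> powr p) UNIV \<le> 1 / Suc k" by metis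
  define \<phi> where "\<phi> k x = (if x \<in> F k then u x else 0)" for k x
  define C where "C = 2 powr p * card (steps :: (int ^ 'n) set) + 1"
  have eq: "\<bar>u x - \<phi> k x\<bar> powr p = (if x \<in> F k then 0 else \<bar>u x\<bar> powr p)" for k x
    by (simp add: \<phi>_def)
  have le: "W1p_norm p (\<lambda>x. u x - \<phi> k x) \<le> (C * (1 / Suc k)) powr (1 / p)" for k
  proof -
    have s: "(\<lambda>x. \<bar>u x - \<phi> k x\<bar> powr p) summable_on UNIV"
      unfolding eq by (rule summable_on_comparison_test[OF w]) auto
    have m: "mass p (\<lambda>x. u x - \<phi> k x) \<le> 1 / Suc k" using F(2)[of k] by (simp add: mass_def eq)
    have "infsum (edge_energy p (\<lambda>x. u x - \<phi> k x)) UNIV + mass p (\<lambda>x. u x - \<phi> k x) \<le> C * mass p (\<lambda>x. u x - \<phi> k x)"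
      using edge_energy_summable(2)[OF _ s] p by (simp add: C_def algebra_simps)
    also have "\<dots> \<le> C * (1 / Suc k)" using m by (intro mult_left_mono) (auto simp: C_def)
    finally show ?thesis unfolding norm_eq[OF s]
      using p by (intro powr_mono2) (auto intro!: add_nonneg_nonneg infsum_nonneg mass_nonneg edge_energy_nonneg)
  qed
  have "(\<lambda>k. W1p_norm p (\<lambda>x. u x - \<phi> k x)) \<longlonglongrightarrow> 0"
  proof (rule Lim_null_comparison)
    show "\<forall>\<^sub>F k in sequentially. norm (W1p_norm p (\<lambda>x. u x - \<phi> k x)) \<le> (C * (1 / Suc k)) powr (1 / p)"
      using le by (auto simp: W1p_norm_def)
    have "(\<lambda>k. C * (1 / Suc k)) \<longlonglongrightarrow> 0"
      using tendsto_mult_right_zero[OF LIMSEQ_inverse_real_of_nat, of C] by (simp add: inverse_eq_divide)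
    then show "(\<lambda>k. (C * (1 / Suc k)) powr (1 / p)) \<longlonglongrightarrow> 0"
      using p by (intro tendsto_zero_powrI[where b = "1/p"]) (auto simp: C_def intro!: eventuallyI)
  qed
  moreover have "finite {x. \<phi> k x \<noteq> 0}" for k
    by (rule finite_subset[OF _ F(1)[of k]]) (auto simp: \<phi>_def)
  ultimately show "u \<in> W1p p"
    using w edge_energy_summable(1)[of p u] p
    by (auto simp: W1p_def integrable_count_space_iff grad_norm_powr intro!: summable_on_add)
qed

context
  fixes p :: real and V :: "int ^ 'n \<Rightarrow> real" and B :: real
  assumes p: "p > 1" and V: "\<And>x. \<bar>V x\<bar> \<le> B"
begin

lemma potential_summable:
  assumes "(\<lambda>x. \<bar>u x\<bar> powr p) summable_on UNIV"
  shows "(\<lambda>x. V x * \<bar>u x\<bar> powr p) summable_on UNIV"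
  by (rule summable_on_abs_comparison[OF summable_on_cmult_right[OF assms, of B]])
    (auto simp: abs_mult intro!: mult_right_mono V)

lemma nehari_density_summable:
  assumes "finite_entropy p u"
  shows "nehari_density p V u summable_on UNIV"
  using assms p unfolding finite_entropy_def nehari_density_def
  by (intro summable_on_diff_real summable_on_add edge_energy_summable potential_summable) auto

lemma energy_eq:
  assumes "finite_entropy p u"
  shows "energy p V u = ereal (1 / p * (nehari_functional p V u + mass p u))"
proof -
  have w: "(\<lambda>x. \<bar>u x\<bar> powr p) summable_on UNIV" and
    e: "(\<lambda>x. \<bar>u x\<bar> powr p * ln (\<bar>u x\<bar> powr p)) summable_on UNIV"
    using assms by (auto simp: finite_entropy_def)
  have g: "edge_energy p u summable_on UNIV" using edge_energy_summable(1)[of p u] w p by simp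
  have gV: "(\<lambda>x. edge_energy p u x + (V x + 1) * \<bar>u x\<bar> powr p) summable_on UNIV"
    unfolding ring_distribs mult_1 by (intro summable_on_add g potential_summable w)
  have "nehari_functional p V u + mass p u = infsum (\<lambda>x. nehari_density p V u x + \<bar>u x\<bar> powr p) UNIV"
    using infsum_add[OF nehari_density_summable[OF assms] w] by (simp add: nehari_functional_def mass_def)
  also have "\<dots> = infsum (\<lambda>x. (edge_energy p u x + (V x + 1) * \<bar>u x\<bar> powr p) - \<bar>u x\<bar> powr p * ln (\<bar>u x\<bar> powr p)) UNIV"
    by (simp add: nehari_density_def algebra_simps)
  also have "\<dots> = infsum (\<lambda>x. edge_energy p u x + (V x + 1) * \<bar>u x\<bar> powr p) UNIV -
     infsum (\<lambda>x. \<bar>u x\<bar> powr p * ln (\<bar>u x\<bar> powr p)) UNIV"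
    by (rule infsum_diff_real[OF gV e])
  finally show ?thesis
    using p ext_integral_summable[OF gV] ext_integral_summable[OF e]
    by (simp add: energy_def grad_norm_powr right_diff_distrib)
qed

text \<open>
  For \<open>u \<in> \<ell>\<^sup>p\<close> the positive part of \<open>\<bar>u\<bar>\<^sup>p log \<bar>u\<bar>\<^sup>p\<close> is summable because \<open>\<bar>u\<bar>\<^sup>p\<close> is bounded by the
  mass; if the negative part is not summable, the energy is \<open>+\<infinity>\<close>.
\<close>

lemma energy_domain_iff: "u \<in> energy_domain p V \<longleftrightarrow> finite_entropy p u"
proof
  assume "finite_entropy p u"
  then show "u \<in> energy_domain p V"
    using energy_eq[of u] by (auto simp: energy_domain_def W1p_iff[OF p] finite_entropy_def)
next
  assume u: "u \<in> energy_domain p V"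
  then have w: "(\<lambda>x. \<bar>u x\<bar> powr p) summable_on UNIV"
    by (simp add: energy_domain_def W1p_iff[OF p])
  have g: "edge_energy p u summable_on UNIV" using edge_energy_summable(1)[of p u] w p by simp
  have gV: "(\<lambda>x. edge_energy p u x + (V x + 1) * \<bar>u x\<bar> powr p) summable_on UNIV"
    unfolding ring_distribs mult_1 by (intro summable_on_add g potential_summable w)
  define f where "f = (\<lambda>x. \<bar>u x\<bar> powr p * ln (\<bar>u x\<bar> powr p))"
  define L where "L = ln (mass p u + 1)"
  have "f x \<le> L * \<bar>u x\<bar> powr p" for x
  proof (cases "u x = 0")
    case False
    then have "0 < \<bar>u x\<bar> powr p" by simp
    then have "ln (\<bar>u x\<bar> powr p) \<le> L"
      using powr_le_mass[OF w, of x] mass_nonneg[of p u] unfolding L_def by (subst ln_le_cancel_iff) auto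
    then show ?thesis unfolding f_def by (subst mult.commute) (intro mult_right_mono, auto)
  qed (simp add: f_def)
  then have "(\<integral>\<^sup>+x. ennreal (f x) \<partial>count_space UNIV) \<le> (\<integral>\<^sup>+x. ennreal (L * \<bar>u x\<bar> powr p) \<partial>count_space UNIV)"
    by (intro nn_integral_mono ennreal_leI)
  also have "\<dots> < \<infinity>"
    using summable_on_cmult_right[OF w, of L] integrable_count_space_iff[of "\<lambda>x. L * \<bar>u x\<bar> powr p"]
    by (simp only: real_integrable_def less_top infinity_ennreal_def simp_thms)
  finally have pos: "(\<integral>\<^sup>+x. ennreal (f x) \<partial>count_space UNIV) < \<infinity>" .
  have "f summable_on UNIV"
  proof (rule ccontr)
    assume "\<not> f summable_on UNIV"
    then have "\<not> integrable (count_space UNIV) f" by (simp add: integrable_count_space_iff)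
    then have "(\<integral>\<^sup>+x. ennreal (- f x) \<partial>count_space UNIV) = \<infinity>"
      using pos by (auto simp: real_integrable_def)
    then have "ext_integral f = - \<infinity>"
      using pos by (cases "\<integral>\<^sup>+x. ennreal (f x) \<partial>count_space UNIV") (auto simp: ext_integral_def)
    then have "energy p V u = \<infinity>"
      using p ext_integral_summable[OF gV] unfolding energy_def f_def[symmetric]
      by (simp add: grad_norm_powr)
    then show False using u by (simp add: energy_domain_def)
  qed
  then show "finite_entropy p u" using w by (simp add: finite_entropy_def f_def)
qed

lemma Nehari_iff: "u \<in> Nehari p V \<longleftrightarrow>
  finite_entropy p u \<and> u \<noteq> (\<lambda>x. 0) \<and> nehari_functional p V u = 0"
proof (cases "finite_entropy p u")
  case True
  have w: "(\<lambda>x. \<bar>u x\<bar> powr p) summable_on UNIV" and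
    e: "(\<lambda>x. \<bar>u x\<bar> powr p * ln (\<bar>u x\<bar> powr p)) summable_on UNIV"
    using True by (auto simp: finite_entropy_def)
  have gV: "(\<lambda>x. edge_energy p u x + V x * \<bar>u x\<bar> powr p) summable_on UNIV"
    using p w by (intro summable_on_add edge_energy_summable potential_summable) auto
  have "nehari_functional p V u = infsum (\<lambda>x. edge_energy p u x + V x * \<bar>u x\<bar> powr p) UNIV -
     infsum (\<lambda>x. \<bar>u x\<bar> powr p * ln (\<bar>u x\<bar> powr p)) UNIV"
    unfolding nehari_functional_def nehari_density_def by (rule infsum_diff_real[OF gV e])
  then show ?thesis
    using True p ext_integral_summable[OF gV] ext_integral_summable[OF e]
    by (auto simp: Nehari_def energy_domain_iff grad_norm_powr)
qed (simp add: Nehari_def energy_domain_iff)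

end

lemma mass_scale: "mass p (\<lambda>x. t * u x) = \<bar>t\<bar> powr p * mass p u"
  by (simp add: mass_def abs_mult powr_mult infsum_cmult_right')

lemma entropy_scale:
  fixes s t :: real
  shows "(t * s) * ln (t * s) = t * (s * ln s) + t * ln t * s"
  by (simp add: ln_mult algebra_simps)

lemma finite_entropy_scale:
  assumes "finite_entropy p u"
  shows "finite_entropy p (\<lambda>x. t * u x)"
  using assms unfolding finite_entropy_def abs_mult powr_mult entropy_scale
  by (auto intro!: summable_on_add summable_on_cmult_right)

text \<open>
  The identity that reduces the Nehari manifold to the sphere of unit mass: the logarithm contributes
  only a multiple of the mass.
\<close>

lemma nehari_functional_scale:
  assumes "p > 1" "\<And>x. \<bar>V x\<bar> \<le> B" "finite_entropy p u"
  shows "nehari_functional p V (\<lambda>x. t * u x) =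
    \<bar>t\<bar> powr p * nehari_functional p V u - \<bar>t\<bar> powr p * ln (\<bar>t\<bar> powr p) * mass p u"
proof -
  have *: "nehari_density p V (\<lambda>x. t * u x) x =
    \<bar>t\<bar> powr p * nehari_density p V u x - (\<bar>t\<bar> powr p * ln (\<bar>t\<bar> powr p)) * \<bar>u x\<bar> powr p" for x
  proof -
    have "edge_energy p (\<lambda>x. t * u x) x = \<bar>t\<bar> powr p * edge_energy p u x"
      by (simp add: edge_energy_def abs_mult powr_mult sum_distrib_left mult_ac flip: right_diff_distrib)
    then show ?thesis
      unfolding nehari_density_def abs_mult powr_mult entropy_scale by (simp add: algebra_simps)
  qed
  show ?thesis
    unfolding nehari_functional_def mass_def * 
    using nehari_density_summable[OF assms] assms(3)
    by (subst infsum_diff_real) (auto simp: finite_entropy_def infsum_cmult_right' intro!: summable_on_cmult_right)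
qed

lemma mass_translate: "mass p (\<lambda>x. u (x + a)) = mass p u"
  unfolding mass_def by (rule infsum_translate)

lemma finite_entropy_translate: "finite_entropy p (\<lambda>x. u (x + a)) \<longleftrightarrow> finite_entropy p u"
  unfolding finite_entropy_def
  using summable_on_translate[of "\<lambda>x. \<bar>u x\<bar> powr p" a]
    summable_on_translate[of "\<lambda>x. \<bar>u x\<bar> powr p * ln (\<bar>u x\<bar> powr p)" a] by simp

lemma nehari_functional_translate:
  assumes "\<And>x. V (x + a) = V x"
  shows "nehari_functional p V (\<lambda>x. u (x + a)) = nehari_functional p V u"
proof -
  have "nehari_density p V (\<lambda>x. u (x + a)) x = nehari_density p V u (x + a)" for x
    unfolding nehari_density_def edge_energy_def sum_neighbours assms by (simp add: add_ac)
  then have "nehari_density p V (\<lambda>x. u (x + a)) = (\<lambda>x. nehari_density p V u (x + a))" by (rule ext)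
  then show ?thesis
    unfolding nehari_functional_def using infsum_translate[of "nehari_density p V u" a] by simp
qed

section \<open>Periodicity\<close>

lemma periodic_multiple:
  assumes "periodic T V"
  shows "V (x + int T *s k) = V x"
proof -
  have step: "V (x + m *s (int T *s axis i 1)) = V x" for x i and m :: int
  proof (induction m arbitrary: x rule: int_induct[where k = 0])
    case (step1 m)
    have eq: "x + (m + 1) *s (int T *s axis i 1) = (x + int T *s axis i 1) + m *s (int T *s axis i 1)"
      by (simp add: vec_eq_iff algebra_simps)
    show ?case unfolding eq step1(2) using assms by (simp add: periodic_def)
  next
    case (step2 m)
    have eq: "x + (m - 1) *s (int T *s axis i 1) = (x - int T *s axis i 1) + m *s (int T *s axis i 1)"
      by (simp add: vec_eq_iff algebra_simps)
    show ?case unfolding eq step2(2) using assms by (metis diff_add_cancel periodic_def)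
  qed simp
  have sum: "V (x + (\<Sum>i\<in>I. (k $ i) *s (int T *s axis i 1))) = V x" if "finite I" for I x
    using that
  proof (induction I arbitrary: x)
    case (insert i I)
    then show ?case using step[of "x + (\<Sum>i\<in>I. (k $ i) *s (int T *s axis i 1))" "k $ i" i]
      by (simp add: add_ac)
  qed simp
  have "int T *s k = (\<Sum>i\<in>UNIV. (k $ i) *s (int T *s axis i 1))"
    by (simp add: vec_eq_iff axis_def if_distrib[of "\<lambda>x. _ * x"] cong: if_cong)
  then show ?thesis using sum[of UNIV x] by simp
qed

text \<open>
  The box \<open>{0..<T}\<^sup>N\<close> meets every orbit of the group of periods.
\<close>

lemma fundamental_box:
  assumes "T > 0"
  obtains Q :: "(int ^ 'n) set" where "finite Q" "\<And>x. \<exists>k. x - int T *s k \<in> Q"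
proof
  show "finite (vec_lambda ` (\<Pi>\<^sub>E i\<in>(UNIV :: 'n set). {0..<int T}))"
    by (intro finite_imageI finite_PiE) auto
  show "\<exists>k. x - int T *s k \<in> vec_lambda ` (\<Pi>\<^sub>E i\<in>(UNIV :: 'n set). {0..<int T})" for x
  proof (intro exI image_eqI)
    show "x - int T *s (\<chi> i. x $ i div int T) = vec_lambda (\<lambda>i. x $ i mod int T)"
      by (simp add: vec_eq_iff minus_mult_div_eq_mod)
    show "(\<lambda>i. x $ i mod int T) \<in> (\<Pi>\<^sub>E i\<in>(UNIV :: 'n set). {0..<int T})"
      using assms by auto
  qed
qed

lemma periodic_bounded:
  fixes V :: "int ^ 'n \<Rightarrow> real"
  assumes "T > 0" "periodic T V"
  obtains B where "\<And>x. \<bar>V x\<bar> \<le> B"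
proof -
  obtain Q :: "(int ^ 'n) set" where Q: "finite Q" "\<And>x. \<exists>k. x - int T *s k \<in> Q"
    using fundamental_box[OF assms(1)] by metis
  have "\<bar>V x\<bar> \<le> Max ((\<lambda>x. \<bar>V x\<bar>) ` Q)" for x
  proof -
    obtain k where k: "x - int T *s k \<in> Q" using Q(2) by blast
    have "V x = V (x - int T *s k)" using periodic_multiple[OF assms(2), of "x - int T *s k" k] by simp
    then show ?thesis using k Q(1) by (auto intro!: Max_ge)
  qed
  then show ?thesis using that by blast
qed

section \<open>Pointwise limits and the minimal level\<close>

lemma tendsto_edge_energy:
  assumes "p > 1" "\<And>x. (\<lambda>n. U n x) \<longlonglongrightarrow> u x"
  shows "(\<lambda>n. edge_energy p (U n) x) \<longlonglongrightarrow> edge_energy p u x"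
  unfolding edge_energy_def
  by (intro tendsto_mult tendsto_const tendsto_sum isCont_tendsto_compose[OF isCont_powr_abs] tendsto_diff assms)

lemma tendsto_nehari_density:
  assumes "p > 1" "\<And>x. (\<lambda>n. U n x) \<longlonglongrightarrow> u x"
  shows "(\<lambda>n. nehari_density p V (U n) x) \<longlonglongrightarrow> nehari_density p V u x"
  unfolding nehari_density_def
  by (intro tendsto_intros tendsto_edge_energy isCont_tendsto_compose[OF isCont_entropy]
     isCont_tendsto_compose[OF isCont_powr_abs] assms)

text \<open>
  The infimum \<open>I\<close> of the functional over unit mass. It is the optimal constant of the logarithmic
  Sobolev inequality proved below as \<open>nehari_functional_lower_bound\<close>.
\<close>

definition min_level :: "real \<Rightarrow> (int ^ 'n \<Rightarrow> real) \<Rightarrow> real"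
  where "min_level p V = Inf {nehari_functional p V u | u. finite_entropy p u \<and> mass p u = 1}"

section \<open>Splitting off a finite set\<close>

text \<open>
  The share of the vertex \<open>x\<close> in an upper bound for the energy that edges gain when \<open>u\<close> is
  replaced by its restrictions to \<open>S\<close> and to the complement: only edges that cross the
  boundary of \<open>S\<close> contribute.
\<close>

definition cut_cost :: "real \<Rightarrow> (int ^ 'n \<Rightarrow> real) \<Rightarrow> (int ^ 'n) set \<Rightarrow> int ^ 'n \<Rightarrow> real"
  where "cut_cost p u S x = 1 / 2 * (\<Sum>y | x \<sim>\<^sub>Z y.
    if (x \<in> S) = (y \<in> S) then 0 else \<bar>u x\<bar> powr p + \<bar>u y\<bar> powr p)"

lemma cut_cost_nonneg: "cut_cost p u S x \<ge> 0"
  by (auto simp: cut_cost_def intro!: sum_nonneg)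

lemma finite_entropy_restrict:
  assumes "finite_entropy p u"
  shows "finite_entropy p (\<lambda>x. if x \<in> S then u x else 0)"
proof -
  have *: "f summable_on UNIV \<Longrightarrow> (\<lambda>x. if x \<in> S then f x else 0) summable_on UNIV" for f :: "_ \<Rightarrow> real"
    by (rule summable_on_abs_comparison[of "\<lambda>x. \<bar>f x\<bar>"])
      (use summable_on_iff_abs_summable_on_real[of f UNIV] in auto)
  have "(\<lambda>x. \<bar>if x \<in> S then u x else 0\<bar> powr p) = (\<lambda>x. if x \<in> S then \<bar>u x\<bar> powr p else 0)"
    "(\<lambda>x. \<bar>if x \<in> S then u x else 0\<bar> powr p * ln (\<bar>if x \<in> S then u x else 0\<bar> powr p))
      = (\<lambda>x. if x \<in> S then \<bar>u x\<bar> powr p * ln (\<bar>u x\<bar> powr p) else 0)" by auto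
  then show ?thesis using assms *[of "\<lambda>x. \<bar>u x\<bar> powr p"] *[of "\<lambda>x. \<bar>u x\<bar> powr p * ln (\<bar>u x\<bar> powr p)"]
    unfolding finite_entropy_def by presburger
qed

text \<open>
  Potential and entropy split exactly, since at each vertex one of the two parts vanishes; on a
  crossing edge the energy of the two parts is \<open>\<bar>u x\<bar>\<^sup>p + \<bar>u y\<bar>\<^sup>p\<close>, and that of \<open>u\<close> is dropped.
\<close>

lemma nehari_density_cut:
  "nehari_density p V u x \<ge> nehari_density p V (\<lambda>x. if x \<in> S then u x else 0) x +
     nehari_density p V (\<lambda>x. if x \<in> - S then u x else 0) x - cut_cost p u S x"
proof -
  let ?v = "\<lambda>x. if x \<in> S then u x else 0" and ?z = "\<lambda>x. if x \<in> - S then u x else 0"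
  have "(\<Sum>y | x \<sim>\<^sub>Z y. \<bar>?v y - ?v x\<bar> powr p) + (\<Sum>y | x \<sim>\<^sub>Z y. \<bar>?z y - ?z x\<bar> powr p) \<le>
    (\<Sum>y | x \<sim>\<^sub>Z y. \<bar>u y - u x\<bar> powr p) + (\<Sum>y | x \<sim>\<^sub>Z y.
    if (x \<in> S) = (y \<in> S) then 0 else \<bar>u x\<bar> powr p + \<bar>u y\<bar> powr p)"
    unfolding sum.distrib[symmetric] by (intro sum_mono) auto
  then have "edge_energy p ?v x + edge_energy p ?z x \<le> edge_energy p u x + cut_cost p u S x"
    unfolding edge_energy_def cut_cost_def by linarith
  then show ?thesis unfolding nehari_density_def by (cases "x \<in> S") auto
qed

lemma cut_cost_support:
  assumes "x \<notin> S \<union> (\<Union>a\<in>S. {y. a \<sim>\<^sub>Z y})"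
  shows "cut_cost p u S x = 0"
proof -
  have "y \<notin> S" if "x \<sim>\<^sub>Z y" for y using assms that adj_sym by auto
  then show ?thesis using assms by (auto simp: cut_cost_def intro!: sum.neutral)
qed

text \<open>
  If \<open>S\<close> consists of \<open>F\<close> and its neighbours, both ends of an edge crossing the boundary of \<open>S\<close> lie
  outside \<open>F\<close>. So the cost is bounded by the mass outside \<open>F\<close>, which is small for large \<open>F\<close>.
\<close>

lemma cut_cost_thickened:
  fixes u :: "int ^ 'n \<Rightarrow> real"
  assumes w: "(\<lambda>x. \<bar>u x\<bar> powr p) summable_on UNIV"
  shows "infsum (cut_cost p u (F \<union> (\<Union>a\<in>F. {y. a \<sim>\<^sub>Z y}))) UNIV \<le>
    card (steps :: (int ^ 'n) set) * infsum (\<lambda>x. if x \<in> F then 0 else \<bar>u x\<bar> powr p) UNIV"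
proof -
  let ?S = "F \<union> (\<Union>a\<in>F. {y. a \<sim>\<^sub>Z y})"
  let ?t = "\<lambda>x. if x \<in> F then 0 else \<bar>u x\<bar> powr p"
  have t: "?t summable_on UNIV" by (rule summable_on_comparison_test[OF w]) auto
  have r: "(\<lambda>x. 1/2 * (\<Sum>y | x \<sim>\<^sub>Z y. ?t x + ?t y)) summable_on UNIV"
    using infsum_neighbours_add(1)[OF t] by (rule summable_on_cmult_right)
  have le: "cut_cost p u ?S x \<le> 1/2 * (\<Sum>y | x \<sim>\<^sub>Z y. ?t x + ?t y)" for x
    unfolding cut_cost_def
  proof (intro mult_left_mono sum_mono)
    fix y assume "y \<in> {y. x \<sim>\<^sub>Z y}"
    then have "x \<notin> F \<and> y \<notin> F" if "(x \<in> ?S) \<noteq> (y \<in> ?S)" using that adj_sym[of x y] by auto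
    then show "(if (x \<in> ?S) = (y \<in> ?S) then 0 else \<bar>u x\<bar> powr p + \<bar>u y\<bar> powr p) \<le> ?t x + ?t y"
      by auto
  qed simp
  have "infsum (cut_cost p u ?S) UNIV \<le> infsum (\<lambda>x. 1/2 * (\<Sum>y | x \<sim>\<^sub>Z y. ?t x + ?t y)) UNIV"
    by (rule infsum_mono[OF summable_on_comparison_test[OF r] r]) (rule le cut_cost_nonneg)+
  also have "\<dots> = card (steps :: (int ^ 'n) set) * infsum ?t UNIV"
    unfolding infsum_cmult_right' infsum_neighbours_add(2)[OF t] by simp
  finally show ?thesis .
qed

section \<open>Existence of a minimiser of unit mass\<close>

context
  fixes p :: real and V :: "int ^ 'n \<Rightarrow> real" and B :: real
  assumes p: "p > 1" and V: "\<And>x. \<bar>V x\<bar> \<le> B"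
begin

text \<open>
  Spreading is expensive: small values make \<open>- log \<bar>u\<bar>\<^sup>p\<close> large. With \<open>d = 1\<close> this bounds the
  functional from below on unit mass; with small \<open>d\<close> it prevents vanishing of minimising sequences.
\<close>

lemma nehari_functional_ge_of_spread:
  assumes u: "finite_entropy p u" "mass p u = 1" and d: "d > 0" "\<And>x. \<bar>u x\<bar> powr p \<le> d"
  shows "nehari_functional p V u \<ge> - B - ln d"
proof -
  have w: "(\<lambda>x. \<bar>u x\<bar> powr p) summable_on UNIV" using u by (simp add: finite_entropy_def)
  have "(- B - ln d) * \<bar>u x\<bar> powr p \<le> nehari_density p V u x" for x
  proof -
    have "ln (\<bar>u x\<bar> powr p) * \<bar>u x\<bar> powr p \<le> ln d * \<bar>u x\<bar> powr p"
    proof (cases "u x = 0")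
      case False
      then have "0 < \<bar>u x\<bar> powr p" by simp
      then have "ln (\<bar>u x\<bar> powr p) \<le> ln d" using d by (subst ln_le_cancel_iff) auto
      then show ?thesis by (rule mult_right_mono) simp
    qed simp
    moreover have "- B * \<bar>u x\<bar> powr p \<le> V x * \<bar>u x\<bar> powr p"
      using V[of x] by (intro mult_right_mono) auto
    ultimately show ?thesis using edge_energy_nonneg[of p u x]
      unfolding nehari_density_def left_diff_distrib by (simp add: mult.commute)
  qed
  then have "infsum (\<lambda>x. (- B - ln d) * \<bar>u x\<bar> powr p) UNIV \<le> nehari_functional p V u"
    unfolding nehari_functional_def
    by (intro infsum_mono summable_on_cmult_right w nehari_density_summable[where V = V, OF p V] u)
  then show ?thesis using u(2) unfolding infsum_cmult_right' mass_def by simp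
qed

lemma nehari_functional_bounded_below:
  assumes "finite_entropy p u" "mass p u = 1"
  shows "nehari_functional p V u \<ge> - B"
proof -
  have "\<bar>u x\<bar> powr p \<le> 1" for x using powr_le_mass[of u p x] assms by (simp add: finite_entropy_def)
  then show ?thesis using nehari_functional_ge_of_spread[OF assms, of 1] by simp
qed

lemma min_level_le:
  assumes "finite_entropy p u" "mass p u = 1"
  shows "min_level p V \<le> nehari_functional p V u"
  unfolding min_level_def
  by (rule cInf_lower) (use assms nehari_functional_bounded_below in \<open>auto intro!: bdd_belowI[of _ "-B"]\<close>)

lemma min_level_approx:
  assumes "e > 0"
  obtains u where "finite_entropy p u" "mass p u = 1" "nehari_functional p V u < min_level p V + e"
proof -
  let ?X = "{nehari_functional p V u | u. finite_entropy p u \<and> mass p u = 1}"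
  define d :: "int ^ 'n \<Rightarrow> real" where "d = (\<lambda>x. if x = 0 then 1 else 0)"
  have d0: "x \<notin> {0} \<Longrightarrow> d x = 0" for x by (simp add: d_def)
  have "finite_entropy p d" unfolding finite_entropy_def
    using infsum_finite_support(1)[of "{0}" "\<lambda>x. \<bar>d x\<bar> powr p"] d0
      infsum_finite_support(1)[of "{0}" "\<lambda>x. \<bar>d x\<bar> powr p * ln (\<bar>d x\<bar> powr p)"] by simp
  moreover have "mass p d = 1"
    using infsum_finite_support(2)[of "{0}" "\<lambda>x. \<bar>d x\<bar> powr p"] d0 by (simp add: mass_def d_def)
  ultimately have "?X \<noteq> {}" by auto
  from cInf_lessD[OF this, of "min_level p V + e"] show ?thesis
    using assms that by (auto simp: min_level_def)
qed

text \<open>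
  The definition of the minimal level, applied to the multiple of \<open>u\<close> that has unit mass.
\<close>

lemma nehari_functional_lower_bound:
  assumes u: "finite_entropy p u"
  shows "nehari_functional p V u \<ge> min_level p V * mass p u - mass p u * ln (mass p u)"
proof (cases "u = (\<lambda>x. 0)")
  case True
  then show ?thesis by (simp add: mass_def nehari_functional_def nehari_density_def edge_energy_def)
next
  case False
  define m where "m = mass p u"
  have m: "m > 0" using mass_pos[OF _ False] u by (simp add: m_def finite_entropy_def)
  define t where "t = m powr (- 1 / p)"
  have "t powr p = m powr (- 1 / p * p)" by (simp only: t_def powr_powr)
  then have t: "\<bar>t\<bar> powr p = 1 / m" using p m by (simp add: t_def powr_minus_divide)
  have "min_level p V \<le> nehari_functional p V (\<lambda>x. t * u x)"
    using m by (intro min_level_le finite_entropy_scale u) (simp add: mass_scale t flip: m_def)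
  also have "\<dots> = nehari_functional p V u / m + ln m"
    unfolding nehari_functional_scale[where V = V, OF p V u] t m_def[symmetric] using m by (simp add: ln_div)
  finally have "min_level p V * m \<le> (nehari_functional p V u / m + ln m) * m"
    using m by (intro mult_right_mono) auto
  then show ?thesis using m by (simp add: m_def algebra_simps)
qed

text \<open>
  The lower bound for arbitrary mass, applied to the restrictions of \<open>u\<close> to \<open>S\<close> and to its
  complement, of masses \<open>m\<close> and \<open>1 - m\<close>. The entropy of the splitting of the mass is a definite
  gain, strict for \<open>0 < m < 1\<close>; it excludes dichotomy.
\<close>

lemma nehari_functional_cut:
  assumes u: "finite_entropy p u" "mass p u = 1" and S: "finite S"
  defines "m \<equiv> \<Sum>x\<in>S. \<bar>u x\<bar> powr p"
  shows "nehari_functional p V u \<ge>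
    min_level p V - m * ln m - (1 - m) * ln (1 - m) - infsum (cut_cost p u S) UNIV"
proof -
  let ?v = "\<lambda>x. if x \<in> S then u x else 0" and ?z = "\<lambda>x. if x \<in> - S then u x else 0"
  have w: "(\<lambda>x. \<bar>u x\<bar> powr p) summable_on UNIV" using u by (simp add: finite_entropy_def)
  have v: "finite_entropy p ?v" and z: "finite_entropy p ?z"
    using finite_entropy_restrict[OF u(1), of S] finite_entropy_restrict[OF u(1), of "- S"] by blast+
  have c: "cut_cost p u S summable_on UNIV"
    by (rule infsum_finite_support(1)[of "S \<union> (\<Union>a\<in>S. {y. a \<sim>\<^sub>Z y})"])
      (use S finite_neighbours in \<open>auto intro!: cut_cost_support\<close>)
  have mv: "mass p ?v = m"
    unfolding mass_def m_def by (subst infsum_finite_support(2)[OF S]) auto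
  have "mass p ?v + mass p ?z = infsum (\<lambda>x. \<bar>?v x\<bar> powr p + \<bar>?z x\<bar> powr p) UNIV"
    unfolding mass_def by (subst infsum_add) (use v z in \<open>auto simp: finite_entropy_def\<close>)
  also have "(\<lambda>x. \<bar>?v x\<bar> powr p + \<bar>?z x\<bar> powr p) = (\<lambda>x. \<bar>u x\<bar> powr p)" by auto
  finally have mz: "mass p ?z = 1 - m" using u(2) mv unfolding mass_def by simp
  have sv: "nehari_density p V ?v summable_on UNIV" and sz: "nehari_density p V ?z summable_on UNIV"
    using nehari_density_summable[where V = V, OF p V] v z by blast+
  have "infsum (\<lambda>x. nehari_density p V ?v x + nehari_density p V ?z x - cut_cost p u S x) UNIV
      = nehari_functional p V ?v + nehari_functional p V ?z - infsum (cut_cost p u S) UNIV"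
    unfolding nehari_functional_def
    by (subst infsum_diff_real, (intro summable_on_add sv sz c)+, subst infsum_add, (intro sv sz)+, rule refl)
  moreover have "infsum (\<lambda>x. nehari_density p V ?v x + nehari_density p V ?z x - cut_cost p u S x) UNIV
      \<le> nehari_functional p V u"
    unfolding nehari_functional_def
    by (intro infsum_mono summable_on_diff_real summable_on_add sv sz c
        nehari_density_summable[where V = V, OF p V] u nehari_density_cut)
  ultimately show ?thesis
    using nehari_functional_lower_bound[OF v] nehari_functional_lower_bound[OF z]
    unfolding mv mz by (simp add: algebra_simps)
qed

text \<open>
  A pointwise limit of a minimising sequence can only fail to be a minimiser by losing mass. Cutting
  at a finite set \<open>S\<close> and passing to the limit, where all quantities attached to \<open>S\<close> are finite sums
  and converge, shows that the mass \<open>m\<close> that remains satisfies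
  \<open>- m log m - (1 - m) log (1 - m) \<le> 0\<close>, so \<open>m = 1\<close>. Then Fatou's lemma applies
  to the density after \<open>B \<bar>u\<bar>\<^sup>p\<close> has been added to make it nonnegative.
\<close>

lemma min_sequence_limit:
  assumes U: "\<And>n. finite_entropy p (U n)" "\<And>n. mass p (U n) = 1"
    and E: "(\<lambda>n. nehari_functional p V (U n)) \<longlonglongrightarrow> min_level p V"
    and lim: "\<And>x. (\<lambda>n. U n x) \<longlonglongrightarrow> u x"
    and nz: "u \<noteq> (\<lambda>x. 0)"
  shows "finite_entropy p u" "mass p u = 1" "nehari_functional p V u = min_level p V"
proof -
  have wU: "(\<lambda>x. \<bar>U n x\<bar> powr p) summable_on UNIV" for n using U by (simp add: finite_entropy_def)
  have wlim: "(\<lambda>n. \<bar>U n x\<bar> powr p) \<longlonglongrightarrow> \<bar>u x\<bar> powr p" for x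
    by (rule isCont_tendsto_compose[OF isCont_powr_abs[OF p] lim])
  have "(\<lambda>n. infsum (\<lambda>x. \<bar>U n x\<bar> powr p) UNIV) \<longlonglongrightarrow> 1"
    using U(2) unfolding mass_def by simp
  note fat = infsum_fatou[OF _ wU wlim this]
  have w: "(\<lambda>x. \<bar>u x\<bar> powr p) summable_on UNIV" using fat by simp
  define m where "m = mass p u"
  have m: "0 < m" "m \<le> 1" using fat mass_pos[OF w nz] by (auto simp: m_def mass_def)
  define D where "D = real (card (steps :: (int ^ 'n) set))"
  have cut: "\<exists>m'. \<bar>m' - m\<bar> \<le> e \<and> - (m' * ln m') - (1 - m') * ln (1 - m') \<le> D * e" if e: "e > 0" for e
  proof -
    obtain F where F: "finite F" "infsum (\<lambda>x. if x \<in> F then 0 else \<bar>u x\<bar> powr p) UNIV \<le> e"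
      using summable_tail_small[OF w e] by metis
    define S where "S = F \<union> (\<Union>a\<in>F. {y. a \<sim>\<^sub>Z y})"
    \<comment> \<open>\<open>S'\<close> contains every vertex at which cutting at \<open>S\<close> costs anything.\<close>
    define S' where "S' = S \<union> (\<Union>a\<in>S. {y. a \<sim>\<^sub>Z y})"
    have S: "finite S" "finite S'" using F by (auto simp: S_def S'_def finite_neighbours)
    define mS where "mS v = (\<Sum>x\<in>S. \<bar>v x\<bar> powr p)" for v :: "int ^ 'n \<Rightarrow> real"
    have cc: "infsum (cut_cost p v S) UNIV = sum (cut_cost p v S) S'" for v :: "int ^ 'n \<Rightarrow> real"
      using S(2) by (rule infsum_finite_support) (auto simp: S'_def intro!: cut_cost_support)
    have ml: "(\<lambda>n. mS (U n)) \<longlonglongrightarrow> mS u" unfolding mS_def by (intro tendsto_sum wlim)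
    have "(\<lambda>n. if (x \<in> S) = (y \<in> S) then 0 else \<bar>U n x\<bar> powr p + \<bar>U n y\<bar> powr p) \<longlonglongrightarrow>
        (if (x \<in> S) = (y \<in> S) then 0 else \<bar>u x\<bar> powr p + \<bar>u y\<bar> powr p)" for x y
      by (auto intro!: tendsto_add wlim)
    then have cl: "(\<lambda>n. sum (cut_cost p (U n) S) S') \<longlonglongrightarrow> sum (cut_cost p u S) S'"
      unfolding cut_cost_def by (intro tendsto_sum tendsto_mult tendsto_const)
    have "min_level p V - mS u * ln (mS u) - (1 - mS u) * ln (1 - mS u) - sum (cut_cost p u S) S'
        \<le> min_level p V"
    proof (rule LIMSEQ_le[OF _ E])
      show "(\<lambda>n. min_level p V - mS (U n) * ln (mS (U n)) - (1 - mS (U n)) * ln (1 - mS (U n))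
          - sum (cut_cost p (U n) S) S') \<longlonglongrightarrow>
        min_level p V - mS u * ln (mS u) - (1 - mS u) * ln (1 - mS u) - sum (cut_cost p u S) S'"
        by (intro tendsto_diff tendsto_const cl ml isCont_tendsto_compose[OF isCont_entropy])
      show "\<exists>N. \<forall>n\<ge>N. min_level p V - mS (U n) * ln (mS (U n)) - (1 - mS (U n)) * ln (1 - mS (U n))
          - sum (cut_cost p (U n) S) S' \<le> nehari_functional p V (U n)"
        using nehari_functional_cut[OF U S(1)] unfolding mS_def cc by auto
    qed
    moreover have "sum (cut_cost p u S) S' \<le> D * e"
    proof -
      have "sum (cut_cost p u S) S' \<le> D * infsum (\<lambda>x. if x \<in> F then 0 else \<bar>u x\<bar> powr p) UNIV"
        using cut_cost_thickened[OF w, of F] unfolding D_def S_def[symmetric] cc .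
      also have "\<dots> \<le> D * e" using F(2) by (intro mult_left_mono) (auto simp: D_def)
      finally show ?thesis .
    qed
    ultimately have "- (mS u * ln (mS u)) - (1 - mS u) * ln (1 - mS u) \<le> D * e" by linarith
    moreover have "\<bar>mS u - m\<bar> \<le> e"
    proof -
      have up: "mS u \<le> m" unfolding mS_def m_def mass_def by (rule finite_sum_le_infsum[OF w S(1)]) auto
      have sF: "(\<lambda>x. if x \<in> F then \<bar>u x\<bar> powr p else 0) summable_on UNIV"
        "infsum (\<lambda>x. if x \<in> F then \<bar>u x\<bar> powr p else 0) UNIV = (\<Sum>x\<in>F. \<bar>u x\<bar> powr p)"
        using infsum_finite_support[OF F(1), of "\<lambda>x. if x \<in> F then \<bar>u x\<bar> powr p else 0"] by auto
      have "(\<lambda>x. if x \<in> F then 0 else \<bar>u x\<bar> powr p) = (\<lambda>x. \<bar>u x\<bar> powr p - (if x \<in> F then \<bar>u x\<bar> powr p else 0))"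
        by auto
      then have "m - (\<Sum>x\<in>F. \<bar>u x\<bar> powr p) \<le> e"
        using F(2) infsum_diff_real[OF w sF(1)] sF(2) by (simp add: m_def mass_def)
      moreover have "(\<Sum>x\<in>F. \<bar>u x\<bar> powr p) \<le> mS u"
        unfolding mS_def by (rule sum_mono2) (use S in \<open>auto simp: S_def\<close>)
      ultimately show ?thesis using up by linarith
    qed
    ultimately show ?thesis by blast
  qed
  have "\<forall>k. \<exists>m'. \<bar>m' - m\<bar> \<le> 1 / Suc k \<and> - (m' * ln m') - (1 - m') * ln (1 - m') \<le> D * (1 / Suc k)"
    by (intro allI cut) simp
  then obtain M where M: "\<And>k. \<bar>M k - m\<bar> \<le> 1 / Suc k"
    "\<And>k. - (M k * ln (M k)) - (1 - M k) * ln (1 - M k) \<le> D * (1 / Suc k)" by metis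
  have z: "(\<lambda>k. 1 / real (Suc k)) \<longlonglongrightarrow> 0"
    using LIMSEQ_inverse_real_of_nat by (simp add: inverse_eq_divide)
  have "(\<lambda>k. M k - m) \<longlonglongrightarrow> 0"
    by (rule Lim_null_comparison[OF _ z]) (use M in auto)
  then have Mm: "M \<longlonglongrightarrow> m" by (rule LIM_zero_cancel)
  have "- (m * ln m) - (1 - m) * ln (1 - m) \<le> D * 0"
  proof (rule LIMSEQ_le)
    show "(\<lambda>k. - (M k * ln (M k)) - (1 - M k) * ln (1 - M k)) \<longlonglongrightarrow> - (m * ln m) - (1 - m) * ln (1 - m)"
      by (intro tendsto_diff tendsto_minus tendsto_const Mm isCont_tendsto_compose[OF isCont_entropy])
    show "(\<lambda>k. D * (1 / Suc k)) \<longlonglongrightarrow> D * 0" by (intro tendsto_mult tendsto_const z)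
  qed (use M in auto)
  moreover have "- (m * ln m) - (1 - m) * ln (1 - m) > 0" if "m < 1"
  proof -
    have "ln m < 0" "ln (1 - m) < 0" using m that by auto
    then have "m * ln m < 0" "(1 - m) * ln (1 - m) < 0" using m that by (auto intro: mult_pos_neg)
    then show ?thesis by linarith
  qed
  ultimately have m1: "m = 1" using m by force
  then show mass1: "mass p u = 1" by (simp add: m_def)

  let ?f = "\<lambda>v x. nehari_density p V v x + B * \<bar>v x\<bar> powr p"
  \<comment> \<open>A function of unit mass has \<open>\<bar>v\<bar>\<^sup>p \<le> 1\<close>, so its entropy density is nonnegative, and it is dominated by the shifted density; the latter yields finite entropy of the limit.\<close>
  have parts: "- (\<bar>v x\<bar> powr p * ln (\<bar>v x\<bar> powr p)) \<le> ?f v x" "0 \<le> - (\<bar>v x\<bar> powr p * ln (\<bar>v x\<bar> powr p))"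
    if v: "(\<lambda>x. \<bar>v x\<bar> powr p) summable_on UNIV" "mass p v = 1" for v x
  proof -
    have "0 \<le> (V x + B) * \<bar>v x\<bar> powr p" using V[of x] by simp
    then show "- (\<bar>v x\<bar> powr p * ln (\<bar>v x\<bar> powr p)) \<le> ?f v x"
      using edge_energy_nonneg[of p v x] by (simp add: nehari_density_def algebra_simps)
    have "\<bar>v x\<bar> powr p \<le> 1" using powr_le_mass[OF v(1), of x] v(2) by simp
    then have "ln (\<bar>v x\<bar> powr p) \<le> 0" by (cases "v x = 0") (simp_all del: ln_powr)
    then show "0 \<le> - (\<bar>v x\<bar> powr p * ln (\<bar>v x\<bar> powr p))"
      using mult_nonneg_nonpos[of "\<bar>v x\<bar> powr p" "ln (\<bar>v x\<bar> powr p)"] by simp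
  qed
  have fs: "?f v summable_on UNIV" "infsum (?f v) UNIV = nehari_functional p V v + B * mass p v"
    if v: "finite_entropy p v" for v
  proof -
    have d: "nehari_density p V v summable_on UNIV"
      by (rule nehari_density_summable[where V = V, OF p V v])
    have b: "(\<lambda>x. B * \<bar>v x\<bar> powr p) summable_on UNIV"
      using v by (intro summable_on_cmult_right) (simp add: finite_entropy_def)
    show "?f v summable_on UNIV" by (rule summable_on_add[OF d b])
    show "infsum (?f v) UNIV = nehari_functional p V v + B * mass p v"
      unfolding infsum_add[OF d b] by (simp add: nehari_functional_def mass_def infsum_cmult_right')
  qed
  have "(\<lambda>n. infsum (?f (U n)) UNIV) \<longlonglongrightarrow> min_level p V + B"
    unfolding fs(2)[OF U(1)] U(2) by (intro tendsto_add E) simp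
  note fat2 = infsum_fatou[OF _ fs(1)[OF U(1)] _ this, where g = "?f u"]
  have f0: "?f (U n) x \<ge> 0" for n x using parts[OF wU U(2), of n x] by linarith
  have fl: "(\<lambda>n. ?f (U n) x) \<longlonglongrightarrow> ?f u x" for x
    by (intro tendsto_add tendsto_mult tendsto_const wlim tendsto_nehari_density p lim)
  have su: "?f u summable_on UNIV" and le: "infsum (?f u) UNIV \<le> min_level p V + B"
    using fat2 f0 fl by auto
  have "(\<lambda>x. - (\<bar>u x\<bar> powr p * ln (\<bar>u x\<bar> powr p))) summable_on UNIV"
    by (rule summable_on_comparison_test[OF su]) (rule parts[OF w mass1])+
  then show fe: "finite_entropy p u" using w by (simp only: finite_entropy_def summable_on_uminus simp_thms)
  show "nehari_functional p V u = min_level p V"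
    using le fs(2)[OF fe] mass1 min_level_le[OF fe mass1] by simp
qed

end

text \<open>
  Along a minimising sequence the values cannot all be small. Translating by periods changes neither
  mass nor functional and brings a large value into the finite box \<open>Q\<close>, so that the mass in \<open>Q\<close>
  stays above \<open>d\<close> and the pointwise limit is nonzero.
\<close>

lemma exists_unit_mass_minimiser:
  fixes V :: "int ^ 'n \<Rightarrow> real"
  assumes p: "p > 1" and T: "T > 0" "periodic T V"
  obtains u where "finite_entropy p u" "mass p u = 1" "nehari_functional p V u = min_level p V"
proof -
  obtain B where V: "\<And>x. \<bar>V x\<bar> \<le> B" using periodic_bounded[OF T] by blast
  obtain Q :: "(int ^ 'n) set" where Q: "finite Q" "\<And>x. \<exists>k. x - int T *s k \<in> Q"
    using fundamental_box[OF T(1)] by metis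
  \<comment> \<open>For this \<open>d\<close> the bound \<open>- B - ln d\<close> for spread functions equals \<open>I + 2\<close>, above the values of the minimising sequence, which are at most \<open>I + 1\<close>.\<close>
  define d where "d = exp (- (min_level p V + 2 + B))"
  have "\<exists>u. finite_entropy p u \<and> mass p u = 1 \<and> nehari_functional p V u < min_level p V + 1 / Suc n \<and>
    d \<le> (\<Sum>x\<in>Q. \<bar>u x\<bar> powr p)" for n
  proof -
    obtain u where u: "finite_entropy p u" "mass p u = 1" "nehari_functional p V u < min_level p V + 1 / Suc n"
      by (rule min_level_approx[where V = V, OF p V, of "1 / Suc n"]) auto
    have "\<exists>x. d < \<bar>u x\<bar> powr p"
    proof (rule ccontr)
      assume "\<not> (\<exists>x. d < \<bar>u x\<bar> powr p)"
      then have "- B - ln d \<le> nehari_functional p V u"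
        by (intro nehari_functional_ge_of_spread[where V = V, OF p V u(1,2)]) (auto simp: d_def not_less)
      moreover have "1 / real (Suc n) \<le> 1" by simp
      ultimately show False using u(3) by (simp add: d_def)
    qed
    then obtain x where x: "d < \<bar>u x\<bar> powr p" by blast
    obtain k where k: "x - int T *s k \<in> Q" using Q(2) by blast
    define v where "v = (\<lambda>x. u (x + int T *s k))"
    have "d \<le> \<bar>v (x - int T *s k)\<bar> powr p" using x by (simp add: v_def)
    also have "\<dots> \<le> (\<Sum>x\<in>Q. \<bar>v x\<bar> powr p)" by (rule member_le_sum[OF k]) (use Q in auto)
    finally show ?thesis using u
      by (intro exI[of _ v]) (simp add: v_def finite_entropy_translate mass_translate
          nehari_functional_translate periodic_multiple[OF T(2)])
  qed
  then obtain U where U: "\<And>n. finite_entropy p (U n)" "\<And>n. mass p (U n) = 1"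
    "\<And>n. nehari_functional p V (U n) < min_level p V + 1 / Suc n" "\<And>n. d \<le> (\<Sum>x\<in>Q. \<bar>U n x\<bar> powr p)" by metis
  have "norm (U n x) \<le> 1" for n x
  proof (rule ccontr)
    assume "\<not> norm (U n x) \<le> 1"
    then have "1 powr p < \<bar>U n x\<bar> powr p" using p by (intro powr_less_mono2) auto
    then show False using powr_le_mass[of "U n" p x] U(1,2)[of n] by (simp add: finite_entropy_def)
  qed
  then obtain k where k: "strict_mono k" "\<And>x. x \<in> UNIV \<Longrightarrow> \<exists>l. (\<lambda>n. U (k n) x) \<longlonglongrightarrow> l"
    by (rule function_convergent_subsequence[of UNIV U 1, rotated]) auto
  define u where "u x = lim (\<lambda>n. U (k n) x)" for x
  have u: "(\<lambda>n. U (k n) x) \<longlonglongrightarrow> u x" for x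
    using k(2)[OF UNIV_I, of x] unfolding u_def convergent_def[symmetric] by (simp only: convergent_LIMSEQ_iff)
  have wlim: "(\<lambda>n. \<bar>U (k n) x\<bar> powr p) \<longlonglongrightarrow> \<bar>u x\<bar> powr p" for x
    by (rule isCont_tendsto_compose[OF isCont_powr_abs[OF p] u])
  have "d \<le> (\<Sum>x\<in>Q. \<bar>u x\<bar> powr p)"
    by (rule LIMSEQ_le_const[OF tendsto_sum[OF wlim]]) (use U(4) in auto)
  then have nz: "u \<noteq> (\<lambda>x. 0)" by (auto simp: d_def)
  have E: "(\<lambda>n. nehari_functional p V (U n)) \<longlonglongrightarrow> min_level p V"
  proof (rule tendsto_sandwich[OF _ _ tendsto_const])
    show "\<forall>\<^sub>F n in sequentially. min_level p V \<le> nehari_functional p V (U n)"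
      using min_level_le[where V = V, OF p V U(1,2)] by simp
    show "\<forall>\<^sub>F n in sequentially. nehari_functional p V (U n) \<le> min_level p V + 1 / Suc n"
      using U(3) by (auto intro!: eventuallyI less_imp_le)
    show "(\<lambda>n. min_level p V + 1 / Suc n) \<longlonglongrightarrow> min_level p V"
      using LIMSEQ_inverse_real_of_nat_add[of "min_level p V"] by (simp add: inverse_eq_divide)
  qed
  have E': "(\<lambda>n. nehari_functional p V (U (k n))) \<longlonglongrightarrow> min_level p V"
    using LIMSEQ_subseq_LIMSEQ[OF E k(1)] by (simp add: o_def)
  show ?thesis
    using min_sequence_limit[where V = V, OF p V U(1) U(2) E' u nz] that by blast
qed

section \<open>Changing one value\<close>

lemma finite_entropy_update:
  assumes "finite_entropy p u"
  shows "finite_entropy p (u(x := r))"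
    and "mass p (u(x := r)) = mass p u + (\<bar>r\<bar> powr p - \<bar>u x\<bar> powr p)"
proof -
  let ?v = "u(x := r)"
  have w: "(\<lambda>x. \<bar>u x\<bar> powr p) summable_on UNIV"
    and e: "(\<lambda>x. \<bar>u x\<bar> powr p * ln (\<bar>u x\<bar> powr p)) summable_on UNIV"
    using assms by (auto simp: finite_entropy_def)
  have "(\<lambda>y. \<bar>?v y\<bar> powr p) summable_on UNIV"
    by (rule infsum_finite_change(1)[OF w, of "{x}"]) auto
  moreover have "(\<lambda>y. \<bar>?v y\<bar> powr p * ln (\<bar>?v y\<bar> powr p)) summable_on UNIV"
    by (rule infsum_finite_change(1)[OF e, of "{x}"]) auto
  ultimately show "finite_entropy p ?v" by (simp add: finite_entropy_def)
  have "infsum (\<lambda>y. \<bar>?v y\<bar> powr p) UNIV = infsum (\<lambda>x. \<bar>u x\<bar> powr p) UNIV + (\<Sum>y\<in>{x}. \<bar>?v y\<bar> powr p - \<bar>u y\<bar> powr p)"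
    by (rule infsum_finite_change(2)[OF w]) auto
  then show "mass p ?v = mass p u + (\<bar>r\<bar> powr p - \<bar>u x\<bar> powr p)" by (simp add: mass_def)
qed

lemma edge_energy_update_self:
  "edge_energy p (u(x := r)) x = 1 / 2 * (\<Sum>y | x \<sim>\<^sub>Z y. \<bar>u y - r\<bar> powr p)"
  unfolding edge_energy_def by (intro arg_cong2[where f = "(*)"] sum.cong) (auto simp: not_adj_self)

lemma edge_energy_update_neighbour:
  assumes "x \<sim>\<^sub>Z z"
  shows "edge_energy p (u(x := r)) z - edge_energy p u z = 1 / 2 * (\<bar>u z - r\<bar> powr p - \<bar>u z - u x\<bar> powr p)"
proof -
  have zx: "z \<noteq> x" "z \<sim>\<^sub>Z x" using assms adj_sym not_adj_self by auto
  have "(\<Sum>y | z \<sim>\<^sub>Z y. \<bar>(u(x := r)) y - (u(x := r)) z\<bar> powr p) - (\<Sum>y | z \<sim>\<^sub>Z y. \<bar>u y - u z\<bar> powr p)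
    = (\<Sum>y | z \<sim>\<^sub>Z y. if y = x then \<bar>u z - r\<bar> powr p - \<bar>u z - u x\<bar> powr p else 0)"
    unfolding sum_subtractf[symmetric] using zx(1) by (intro sum.cong) (auto simp: abs_minus_commute)
  also have "\<dots> = \<bar>u z - r\<bar> powr p - \<bar>u z - u x\<bar> powr p"
    using zx(2) by (simp add: finite_neighbours)
  finally show ?thesis unfolding edge_energy_def by simp
qed

lemma edge_energy_update_far:
  assumes "z \<noteq> x" "\<not> x \<sim>\<^sub>Z z"
  shows "edge_energy p (u(x := r)) z = edge_energy p u z"
  unfolding edge_energy_def using assms adj_sym[of x z]
  by (intro arg_cong2[where f = "(*)"] sum.cong) auto

text \<open>
  Each edge at \<open>x\<close> is counted once at \<open>x\<close> and once at the other end, with weight \<open>1/2\<close>. The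
  right-hand side is a finite expression in \<open>r\<close>, so it can be differentiated without any
  interchange of limits.
\<close>

lemma nehari_functional_update:
  assumes "nehari_density p V u summable_on UNIV"
  shows "nehari_functional p V (u(x := r)) = nehari_functional p V u +
    (\<Sum>y | x \<sim>\<^sub>Z y. \<bar>u y - r\<bar> powr p - \<bar>u y - u x\<bar> powr p) + V x * (\<bar>r\<bar> powr p - \<bar>u x\<bar> powr p)
    - (\<bar>r\<bar> powr p * ln (\<bar>r\<bar> powr p) - \<bar>u x\<bar> powr p * ln (\<bar>u x\<bar> powr p))"
proof -
  let ?v = "u(x := r)" and ?N = "{y. x \<sim>\<^sub>Z y}"
  let ?D = "\<lambda>y. \<bar>u y - r\<bar> powr p - \<bar>u y - u x\<bar> powr p"
  have "nehari_functional p V ?v = nehari_functional p V u +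
    (\<Sum>z\<in>insert x ?N. nehari_density p V ?v z - nehari_density p V u z)"
    unfolding nehari_functional_def
    by (rule infsum_finite_change(2)[OF assms])
      (auto simp: finite_neighbours nehari_density_def edge_energy_update_far)
  also have "(\<Sum>z\<in>insert x ?N. nehari_density p V ?v z - nehari_density p V u z) =
    (nehari_density p V ?v x - nehari_density p V u x) + (\<Sum>z\<in>?N. nehari_density p V ?v z - nehari_density p V u z)"
    by (rule sum.insert) (auto simp: finite_neighbours not_adj_self)
  also have "(\<Sum>z\<in>?N. nehari_density p V ?v z - nehari_density p V u z) = (\<Sum>z\<in>?N. 1 / 2 * ?D z)"
  proof (rule sum.cong)
    fix z assume "z \<in> ?N"
    then have "x \<sim>\<^sub>Z z" "z \<noteq> x" using not_adj_self by auto
    then show "nehari_density p V ?v z - nehari_density p V u z = 1 / 2 * ?D z"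
      using edge_energy_update_neighbour[of x z p u r] by (simp add: nehari_density_def)
  qed simp
  also have "\<dots> = 1 / 2 * (\<Sum>z\<in>?N. ?D z)" by (simp only: sum_distrib_left)
  also have "nehari_density p V ?v x - nehari_density p V u x = 1 / 2 * (\<Sum>z\<in>?N. ?D z) +
    V x * (\<bar>r\<bar> powr p - \<bar>u x\<bar> powr p) - (\<bar>r\<bar> powr p * ln (\<bar>r\<bar> powr p) - \<bar>u x\<bar> powr p * ln (\<bar>u x\<bar> powr p))"
    unfolding nehari_density_def edge_energy_update_self sum_subtractf
    by (simp add: edge_energy_def algebra_simps)
  finally show ?thesis by linarith
qed

section \<open>Ground states\<close>

text \<open>
  The elements of the Nehari manifold of the least possible mass \<open>e\<^sup>I\<close>; by
  \<open>ground_state_iff_profile\<close> these are the ground states. The description by real numbers avoids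
  the extended real energy in all arguments about them.
\<close>

definition ground_profile :: "real \<Rightarrow> (int ^ 'n \<Rightarrow> real) \<Rightarrow> (int ^ 'n \<Rightarrow> real) \<Rightarrow> bool"
  where "ground_profile p V u \<longleftrightarrow> finite_entropy p u \<and> u \<noteq> (\<lambda>x. 0) \<and>
    nehari_functional p V u = 0 \<and> mass p u = exp (min_level p V)"

context
  fixes p :: real and V :: "int ^ 'n \<Rightarrow> real" and B :: real
  assumes p: "p > 1" and V: "\<And>x. \<bar>V x\<bar> \<le> B"
begin

lemma Nehari_mass_ge:
  assumes "v \<in> Nehari p V"
  shows "mass p v \<ge> exp (min_level p V)"
proof -
  have v: "finite_entropy p v" "v \<noteq> (\<lambda>x. 0)" "nehari_functional p V v = 0"
    using assms Nehari_iff[where V = V, OF p V] by auto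
  then have m: "mass p v > 0" by (auto intro: mass_pos simp: finite_entropy_def)
  have "mass p v * min_level p V \<le> mass p v * ln (mass p v)"
    using nehari_functional_lower_bound[where V = V, OF p V v(1)] v(3) by (simp add: mult.commute)
  then show ?thesis using m by (simp add: ln_ge_iff)
qed

text \<open>
  The factor \<open>e\<^sup>I\<^sup>/\<^sup>p\<close> is the one for which \<open>t\<^sup>p I - t\<^sup>p log (t\<^sup>p) = 0\<close>.
\<close>

lemma ground_profile_of_minimiser:
  assumes "finite_entropy p u" "mass p u = 1" "nehari_functional p V u = min_level p V"
  shows "ground_profile p V (\<lambda>x. exp (min_level p V / p) * u x)"
proof -
  have t: "\<bar>exp (min_level p V / p)\<bar> powr p = exp (min_level p V)"
    using p by (simp add: powr_def)
  have "mass p (\<lambda>x. exp (min_level p V / p) * u x) = exp (min_level p V)"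
    unfolding mass_scale t assms by simp
  moreover from this have "(\<lambda>x. exp (min_level p V / p) * u x) \<noteq> (\<lambda>x. 0)"
    using mass_zero[of p] by (metis exp_not_eq_zero)
  moreover have "nehari_functional p V (\<lambda>x. exp (min_level p V / p) * u x) = 0"
    unfolding nehari_functional_scale[where V = V, OF p V assms(1)] t assms by simp
  ultimately show ?thesis
    unfolding ground_profile_def using finite_entropy_scale[OF assms(1)] by blast
qed

lemma ground_profile_Nehari: "ground_profile p V u \<Longrightarrow> u \<in> Nehari p V"
  by (simp add: ground_profile_def Nehari_iff[where V = V, OF p V])

lemma energy_Nehari: "v \<in> Nehari p V \<Longrightarrow> energy p V v = ereal (mass p v / p)"
  using energy_eq[where V = V, OF p V, of v] by (simp add: Nehari_iff[where V = V, OF p V])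

lemma energy_infimum:
  assumes "ground_profile p V u"
  shows "(INF v\<in>Nehari p V. energy p V v) = ereal (exp (min_level p V) / p)"
proof (rule antisym)
  show "(INF v\<in>Nehari p V. energy p V v) \<le> ereal (exp (min_level p V) / p)"
    using ground_profile_Nehari[OF assms] assms
    by (intro INF_lower2[of u]) (auto simp: energy_Nehari ground_profile_def)
  show "ereal (exp (min_level p V) / p) \<le> (INF v\<in>Nehari p V. energy p V v)"
    using p by (intro INF_greatest) (auto simp: energy_Nehari intro!: divide_right_mono Nehari_mass_ge)
qed

text \<open>
  As a function of the value \<open>r\<close> at \<open>x\<close>, the quantity \<open>E - I M + M log M\<close> is nonnegative and vanishes
  at \<open>r = u x\<close>, so its derivative is \<open>0\<close> there. Since \<open>log M = I\<close>, the derivatives of \<open>- I M\<close> and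
  \<open>M log M\<close> combine to that of \<open>M\<close> alone, which cancels the extra term from differentiating the
  logarithm in \<open>E\<close>; what remains is \<open>p\<close> times the equation.
\<close>

lemma ground_profile_equation:
  assumes u: "ground_profile p V u"
  shows "- p_Laplacian p u x + V x * \<bar>u x\<bar> powr (p - 2) * u x =
         \<bar>u x\<bar> powr (p - 2) * u x * ln (\<bar>u x\<bar> powr p)"
proof -
  define M I where "M = mass p u" and "I = min_level p V"
  have fe: "finite_entropy p u" and E0: "nehari_functional p V u = 0" and M: "M = exp I"
    using u by (auto simp: ground_profile_def M_def I_def)
  define dM where "dM r = M + (\<bar>r\<bar> powr p - \<bar>u x\<bar> powr p)" for r
  define G where "G r = ((\<Sum>y | x \<sim>\<^sub>Z y. \<bar>u y - r\<bar> powr p - \<bar>u y - u x\<bar> powr p)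
    + V x * (\<bar>r\<bar> powr p - \<bar>u x\<bar> powr p)
    - (\<bar>r\<bar> powr p * ln (\<bar>r\<bar> powr p) - \<bar>u x\<bar> powr p * ln (\<bar>u x\<bar> powr p)))
    - I * dM r + dM r * ln (dM r)" for r
  have G_ge: "G r \<ge> 0" for r
    using nehari_functional_lower_bound[where V = V, OF p V finite_entropy_update(1)[OF fe, of x r]]
      nehari_functional_update[OF nehari_density_summable[where V = V, OF p V fe], of x r]
    unfolding G_def dM_def I_def M_def E0 finite_entropy_update(2)[OF fe] by linarith
  have G0: "G (u x) = 0" by (simp add: G_def dM_def M)
  define \<phi> where "\<phi> t = \<bar>t\<bar> powr (p - 2) * t" for t :: real
  have dp: "((\<lambda>t. \<bar>t\<bar> powr p) has_field_derivative p * \<phi> t) (at t)" for t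
    unfolding \<phi>_def by (rule has_field_derivative_powr_abs[OF p])
  have de: "((\<lambda>t. \<bar>t\<bar> powr p * ln (\<bar>t\<bar> powr p)) has_field_derivative p * \<phi> t * (ln (\<bar>t\<bar> powr p) + 1)) (at t)" for t
    unfolding \<phi>_def by (rule has_field_derivative_entropy_powr_abs[OF p])
  have ds: "((\<lambda>r. \<bar>a - r\<bar> powr p - c) has_field_derivative - (p * \<phi> (a - t))) (at t)" for a c t
    by (rule derivative_eq_intros DERIV_chain2[OF dp] refl)+ simp
  have dMd: "(dM has_field_derivative p * \<phi> (u x)) (at (u x))"
    unfolding dM_def[abs_def] by (rule derivative_eq_intros dp refl)+ simp
  have dML: "((\<lambda>r. dM r * ln (dM r)) has_field_derivative (I + 1) * (p * \<phi> (u x))) (at (u x))"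
  proof (rule DERIV_chain2[OF _ dMd])
    have "dM (u x) = exp I" by (simp add: dM_def M)
    then show "((\<lambda>s. s * ln s) has_field_derivative (I + 1)) (at (dM (u x)))"
      by (auto intro!: derivative_eq_intros)
  qed
  have "(G has_field_derivative ((\<Sum>y | x \<sim>\<^sub>Z y. - (p * \<phi> (u y - u x))) + V x * (p * \<phi> (u x))
      - p * \<phi> (u x) * (ln (\<bar>u x\<bar> powr p) + 1)) - I * (p * \<phi> (u x)) + (I + 1) * (p * \<phi> (u x))) (at (u x))"
    unfolding G_def[abs_def]
    by (rule derivative_eq_intros ds dp de dMd dML refl)+ simp
  from DERIV_local_min[OF this zero_less_one] have
    "((\<Sum>y | x \<sim>\<^sub>Z y. - (p * \<phi> (u y - u x))) + V x * (p * \<phi> (u x))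
      - p * \<phi> (u x) * (ln (\<bar>u x\<bar> powr p) + 1)) - I * (p * \<phi> (u x)) + (I + 1) * (p * \<phi> (u x)) = 0"
    using G_ge G0 by simp
  moreover have "(\<Sum>y | x \<sim>\<^sub>Z y. - (p * \<phi> (u y - u x))) = - (p * p_Laplacian p u x)"
    by (simp add: p_Laplacian_def \<phi>_def sum_negf sum_distrib_left)
  ultimately have "p * (- p_Laplacian p u x + V x * \<phi> (u x) - \<phi> (u x) * ln (\<bar>u x\<bar> powr p)) = 0"
    by (simp add: algebra_simps)
  then have "- p_Laplacian p u x + V x * \<phi> (u x) - \<phi> (u x) * ln (\<bar>u x\<bar> powr p) = 0"
    using p by (simp del: ln_powr)
  then show ?thesis by (simp add: \<phi>_def mult.assoc)
qed

text \<open>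
  The summand \<open>F x y\<close> of \<open>(\<Delta>\<^sub>p u) u\<close> satisfies \<open>F x y + F y x = - \<bar>u y - u x\<bar>\<^sup>p\<close>; averaging the sum with
  its reversal gives the energy of the edges.
\<close>

lemma infsum_p_Laplacian_mult:
  assumes w: "(\<lambda>x. \<bar>u x\<bar> powr p) summable_on UNIV"
  shows "(\<lambda>x. p_Laplacian p u x * u x) summable_on UNIV"
    and "infsum (\<lambda>x. p_Laplacian p u x * u x) UNIV = - infsum (edge_energy p u) UNIV"
proof -
  define F where "F x y = \<bar>u y - u x\<bar> powr (p - 2) * (u y - u x) * u x" for x y
  have F_le: "\<bar>F x y\<bar> \<le> (2 powr p + 1) * (\<bar>u x\<bar> powr p + \<bar>u y\<bar> powr p)" for x y
  proof -
    define a b m where "a = \<bar>u y - u x\<bar>" and "b = \<bar>u x\<bar>" and "m = max a b"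
    have ab: "a \<ge> 0" "b \<ge> 0" "a \<le> m" "b \<le> m" by (auto simp: a_def b_def m_def)
    have "a powr (p - 2) * a = a powr (p - 1)"
      using ab by (cases "a = 0") (auto simp: powr_diff power2_eq_square)
    then have "\<bar>F x y\<bar> = a powr (p - 1) * b" by (simp add: F_def a_def b_def abs_mult)
    also have "\<dots> \<le> m powr (p - 1) * m"
      using ab p by (intro mult_mono powr_mono2) auto
    also have "\<dots> = m powr p" using ab by (cases "m = 0") (auto simp: powr_diff)
    also have "\<dots> \<le> a powr p + b powr p" by (auto simp: m_def max_def)
    also have "a powr p \<le> 2 powr p * (\<bar>u y\<bar> powr p + \<bar>u x\<bar> powr p)"
      unfolding a_def using p by (intro powr_p_diff_le) auto
    finally show ?thesis
      using powr_ge_zero[of "\<bar>u y\<bar>" p] unfolding b_def distrib_left distrib_right by linarith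
  qed
  have s: "(\<lambda>x. F x (x + e)) summable_on UNIV" for e
    by (rule summable_on_abs_comparison[OF summable_on_cmult_right[OF summable_on_add[OF w
        summable_on_translate[THEN iffD2, OF w, of e]]] F_le])
  note swap = infsum_edges_swap[of F, OF s]
  have L: "p_Laplacian p u x * u x = (\<Sum>y | x \<sim>\<^sub>Z y. F x y)" for x
    by (simp add: p_Laplacian_def F_def sum_distrib_right)
  show "(\<lambda>x. p_Laplacian p u x * u x) summable_on UNIV" unfolding L by (rule swap)
  have FF: "F x y + F y x = - (\<bar>u y - u x\<bar> powr p)" for x y
  proof -
    have "F x y + F y x = - (\<bar>u y - u x\<bar> powr (p - 2) * (u y - u x)\<^sup>2)"
      by (simp add: F_def abs_minus_commute power2_eq_square algebra_simps)
    also have "\<bar>u y - u x\<bar> powr (p - 2) * (u y - u x)\<^sup>2 = \<bar>u y - u x\<bar> powr p"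
      by (cases "u y = u x") (auto simp: powr_diff)
    finally show ?thesis .
  qed
  \<comment> \<open>The factor \<open>1/2\<close> in the energy of edges absorbs the factor \<open>2\<close> from adding the reversed sum.\<close>
  have "2 * infsum (\<lambda>x. p_Laplacian p u x * u x) UNIV =
      infsum (\<lambda>x. (\<Sum>y | x \<sim>\<^sub>Z y. F x y) + (\<Sum>y | x \<sim>\<^sub>Z y. F y x)) UNIV"
    unfolding L infsum_add[OF swap(2,3)] using swap(1) by simp
  also have "\<dots> = infsum (\<lambda>x. (- 2) * edge_energy p u x) UNIV"
    unfolding sum.distrib[symmetric] FF by (simp add: edge_energy_def sum_negf)
  finally show "infsum (\<lambda>x. p_Laplacian p u x * u x) UNIV = - infsum (edge_energy p u) UNIV"
    unfolding infsum_cmult_right' by simp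
qed

lemma solution_nehari_functional:
  assumes "is_solution p V u"
  shows "finite_entropy p u" "nehari_functional p V u = 0"
proof -
  show fe: "finite_entropy p u"
    using assms energy_domain_iff[where V = V, OF p V] by (simp add: is_solution_def)
  then have w: "(\<lambda>x. \<bar>u x\<bar> powr p) summable_on UNIV" by (simp add: finite_entropy_def)
  have "nehari_density p V u x = edge_energy p u x + p_Laplacian p u x * u x" for x
  proof -
    have sq: "\<bar>u x\<bar> powr (p - 2) * u x * u x = \<bar>u x\<bar> powr p"
      by (cases "u x = 0") (auto simp: powr_diff power2_eq_square)
    have "(- p_Laplacian p u x + V x * \<bar>u x\<bar> powr (p - 2) * u x) * u x =
         (\<bar>u x\<bar> powr (p - 2) * u x * ln (\<bar>u x\<bar> powr p)) * u x"
      using assms by (simp add: is_solution_def)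
    then have "- (p_Laplacian p u x * u x) + V x * (\<bar>u x\<bar> powr (p - 2) * u x * u x) =
         (\<bar>u x\<bar> powr (p - 2) * u x * u x) * ln (\<bar>u x\<bar> powr p)"
      by (simp add: algebra_simps del: ln_powr)
    then show ?thesis unfolding sq nehari_density_def by linarith
  qed
  then have "nehari_functional p V u = infsum (\<lambda>x. edge_energy p u x + p_Laplacian p u x * u x) UNIV"
    by (simp add: nehari_functional_def)
  also have "\<dots> = 0"
    using edge_energy_summable(1)[OF _ w] p infsum_p_Laplacian_mult[OF w] by (subst infsum_add) auto
  finally show "nehari_functional p V u = 0" .
qed

text \<open>
  Taking absolute values keeps mass, potential and entropy and does not increase any edge term. As
  \<open>u\<close> is minimal for its mass, no edge term may decrease, which excludes neighbours of opposite sign.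
\<close>

lemma ground_profile_abs:
  assumes u: "ground_profile p V u"
  shows "ground_profile p V (\<lambda>x. \<bar>u x\<bar>)"
    and "x \<sim>\<^sub>Z y \<Longrightarrow> u x * u y \<ge> 0"
proof -
  let ?a = "\<lambda>x. \<bar>u x\<bar>"
  have fe: "finite_entropy p u" and nz: "u \<noteq> (\<lambda>x. 0)" and E0: "nehari_functional p V u = 0"
    and m: "mass p u = exp (min_level p V)" using u by (auto simp: ground_profile_def)
  have fa: "finite_entropy p ?a" and ma: "mass p ?a = exp (min_level p V)"
    using fe m by (auto simp: finite_entropy_def mass_def)
  have term_le: "\<bar>\<bar>u y\<bar> - \<bar>u x\<bar>\<bar> powr p \<le> \<bar>u y - u x\<bar> powr p" for x y
    using p by (intro powr_mono2) auto
  have le: "nehari_density p V ?a x \<le> nehari_density p V u x" for x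
    unfolding nehari_density_def edge_energy_def by (simp add: sum_mono term_le)
  have su: "nehari_density p V u summable_on UNIV" and sa: "nehari_density p V ?a summable_on UNIV"
    using nehari_density_summable[where V = V, OF p V] fe fa by blast+
  have "nehari_functional p V ?a \<ge> 0"
    using nehari_functional_lower_bound[where V = V, OF p V fa] unfolding ma by simp
  then have *: "infsum (\<lambda>x. nehari_density p V u x - nehari_density p V ?a x) UNIV \<le> 0"
    using E0 unfolding nehari_functional_def infsum_diff_real[OF su sa] by simp
  \<comment> \<open>A sum of nonnegative differences that is at most \<open>0\<close> has only zero terms.\<close>
  have eq: "nehari_density p V ?a x = nehari_density p V u x" for x
    using finite_sum_le_infsum[OF summable_on_diff_real[OF su sa], of "{x}"] * le by (force intro: antisym)
  have "nehari_functional p V ?a = 0" using E0 eq by (simp add: nehari_functional_def)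
  moreover have "?a \<noteq> (\<lambda>x. 0)" using nz by (auto simp: fun_eq_iff)
  ultimately show "ground_profile p V ?a" using fa ma by (simp add: ground_profile_def)
  show "u x * u y \<ge> 0" if xy: "x \<sim>\<^sub>Z y"
  proof (rule ccontr)
    assume "\<not> 0 \<le> u x * u y"
    then have "\<bar>\<bar>u y\<bar> - \<bar>u x\<bar>\<bar> < \<bar>u y - u x\<bar>" by (auto simp: not_le mult_less_0_iff)
    then have "\<bar>\<bar>u y\<bar> - \<bar>u x\<bar>\<bar> powr p < \<bar>u y - u x\<bar> powr p" using p by (intro powr_less_mono2) auto
    then have "(\<Sum>y | x \<sim>\<^sub>Z y. \<bar>\<bar>u y\<bar> - \<bar>u x\<bar>\<bar> powr p) < (\<Sum>y | x \<sim>\<^sub>Z y. \<bar>u y - u x\<bar> powr p)"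
      using xy term_le finite_neighbours[of x] by (intro sum_strict_mono_ex1) auto
    then show False using eq[of x] by (simp add: nehari_density_def edge_energy_def)
  qed
qed

text \<open>
  The equation is used for \<open>\<bar>u\<bar>\<close> and not for \<open>u\<close>: at a zero it says that a sum of nonnegative
  powers of the neighbouring values vanishes, with no cancellation possible.
\<close>

lemma ground_profile_sign:
  assumes u: "ground_profile p V u"
  shows "(\<forall>x. u x > 0) \<or> (\<forall>x. u x < 0)"
proof -
  note a = ground_profile_abs[OF u]
  have spread: "u y = 0" if "u x = 0" "x \<sim>\<^sub>Z y" for x y
  proof -
    have "(\<Sum>y | x \<sim>\<^sub>Z y. \<bar>u y\<bar> powr (p - 2) * \<bar>u y\<bar>) = 0"
      using ground_profile_equation[OF a(1), of x] that by (simp add: p_Laplacian_def)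
    then have "\<bar>u y\<bar> powr (p - 2) * \<bar>u y\<bar> = 0"
      using that by (subst (asm) sum_nonneg_eq_0_iff) (auto simp: finite_neighbours)
    then show ?thesis by simp
  qed
  have nz: "u x \<noteq> 0" for x
  proof
    assume "u x = 0"
    have "y \<in> {z. u z = 0}" for y
      by (rule lattice_connected[of x]) (use spread \<open>u x = 0\<close> in auto)
    then show False using u by (auto simp: ground_profile_def fun_eq_iff)
  qed
  have same: "u x * u y > 0" if "x \<sim>\<^sub>Z y" for x y
    using a(2)[OF that] nz[of x] nz[of y] by (simp add: less_le)
  show ?thesis
  proof (cases "u 0 > 0")
    case True
    have "y \<in> {z. u z > 0}" for y
      by (rule lattice_connected[of 0]) (use True same in \<open>force simp: zero_less_mult_iff\<close>)+
    then show ?thesis by auto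
  next
    case False
    then have neg: "u 0 < 0" using nz[of 0] by simp
    have "y \<in> {z. u z < 0}" for y
      by (rule lattice_connected[of 0]) (use neg same in \<open>force simp: zero_less_mult_iff\<close>)+
    then show ?thesis by auto
  qed
qed

lemma ground_state_iff_profile:
  assumes "ground_profile p V u0"
  shows "is_ground_state p V u \<longleftrightarrow> ground_profile p V u"
proof
  assume u: "is_ground_state p V u"
  then have fe: "finite_entropy p u" and E: "nehari_functional p V u = 0" and nz: "u \<noteq> (\<lambda>x. 0)"
    using solution_nehari_functional by (auto simp: is_ground_state_def)
  then have "u \<in> Nehari p V" by (simp add: Nehari_iff[where V = V, OF p V])
  then have "mass p u / p = exp (min_level p V) / p"
    using u energy_infimum[OF assms] energy_Nehari by (simp add: is_ground_state_def)
  then show "ground_profile p V u" using fe E nz p by (simp add: ground_profile_def)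
next
  assume u: "ground_profile p V u"
  then have fe: "finite_entropy p u" and nz: "u \<noteq> (\<lambda>x. 0)" by (auto simp: ground_profile_def)
  have "is_solution p V u"
    unfolding is_solution_def using energy_domain_iff[where V = V, OF p V] fe ground_profile_equation[OF u] by blast
  moreover have "energy p V u = (INF v\<in>Nehari p V. energy p V v)"
    using energy_infimum[OF u] energy_Nehari[OF ground_profile_Nehari[OF u]] u by (simp add: ground_profile_def)
  ultimately show "is_ground_state p V u" using nz by (simp add: is_ground_state_def)
qed

end

theorem theorem6p4:
  fixes p :: real and V :: "int ^ 'n \<Rightarrow> real" and T :: nat
  assumes "p > 1"
    and "(INF x. ereal (V x)) > -1"
    and "T > 0" and "periodic T V"
  shows "(\<exists>u. is_ground_state p V u) \<and>
    (\<forall>u. is_ground_state p V u \<longrightarrow> (\<forall>x. u x > 0) \<or> (\<forall>x. u x < 0))"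
proof -
  obtain B where V: "\<And>x. \<bar>V x\<bar> \<le> B" using periodic_bounded[OF assms(3,4)] by blast
  obtain u where u: "finite_entropy p u" "mass p u = 1" "nehari_functional p V u = min_level p V"
    using exists_unit_mass_minimiser[OF assms(1,3,4)] .
  have "ground_profile p V (\<lambda>x. exp (min_level p V / p) * u x)"
    by (rule ground_profile_of_minimiser[where V = V, OF assms(1) V u])
  note iff = ground_state_iff_profile[where V = V, OF assms(1) V this]
  show ?thesis
    unfolding iff using ground_profile_of_minimiser[where V = V, OF assms(1) V u]
      ground_profile_sign[where V = V, OF assms(1) V] by blast
qed

end
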